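(* Let $V:=V_2^2:\mathbb{R}^2\to\mathbb{R}^5$, $V_2^2(x,y)=(x^2,xy,y^2,x,y)$, and let $k\ge 0$ be an integer. Any set of $n$ points of $\mathbb{R}^2$ in general position with respect to conics has exactly $$2\binom{k+2}{2}\binom{n-k-3}{2}$$ $\mathcal{F}_V$-$k$-facets.
   Context: A set of at least $d+1$ points in $\mathbb{R}^d$ is in general linear position if no $d+1$ (and thus no fewer) of its points are affinely dependent. A set $S\subset\mathbb{R}^2$ is in general position with respect to conics if $S$ is in general linear position in $\mathbb{R}^2$ and $V_2^2(S)$ is in general linear position in $\mathbb{R}^5$. For a finite set $P\subset\mathbb{R}^p$ in general linear position, a $k$-facet of $P$ is a pair consisting of a subset $\Delta\subset P$ of $p$ points and an orientation of the hyperplane $\operatorname{aff}\Delta$ such that the open halfspace on the positive side of $\operatorname{aff}\Delta$ contains exactly $k$ points of $P$ (the two orientations of the same hyperplane count as different). For a map $\varphi:\mathbb{R}^2\to\mathbb{R}^p$ and a finite $S\subset\mathbb{R}^2$ with $\varphi(S)$ in general linear position, an $\mathcal{F}_\varphi$-$k$-facet of $S$ is a subset $Q\subset S$ of $p$ points together with an orientation of $\operatorname{aff}\varphi(Q)$ such that $\varphi(Q)$ with this orientation is a $k$-facet of $\varphi(S)$. Convention: $\binom{a}{b}=0$ for integers $a<b$, $b\ge 0$ (including $a<0$); the formula is of interest for $0\le k\le n-5$. *)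

theory Defs
  imports "HOL-Analysis.Analysis"
begin

definition general_linear_position :: "'a::euclidean_space set \<Rightarrow> bool" where
  "general_linear_position P \<longleftrightarrow>
     (finite P \<longrightarrow> DIM('a) + 1 \<le> card P) \<and>
     (\<forall>T\<subseteq>P. card T = DIM('a) + 1 \<longrightarrow> \<not> affine_dependent T)"

definition V22 :: "real^2 \<Rightarrow> real^5" where
  "V22 p = vector [(p$1)^2, p$1 * p$2, (p$2)^2, p$1, p$2]"

definition general_position_conics :: "(real^2) set \<Rightarrow> bool" where
  "general_position_conics S \<longleftrightarrow>
     general_linear_position S \<and> general_linear_position (V22 ` S)"

(* An orientation of a hyperplane is encoded by its open positive side.  A hyperplane has
   exactly two open sides, and either one determines the hyperplane, so this set has
   exactly two elements when A is a hyperplane, and it is empty otherwise. *)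
definition orientations :: "'a::euclidean_space set \<Rightarrow> 'a set set" where
  "orientations A = {H. \<exists>a b. a \<noteq> 0 \<and> A = {x. a \<bullet> x = b} \<and> H = {x. a \<bullet> x > b}}"

(* Meaningful for finite P in general linear position. *)
definition k_facets :: "nat \<Rightarrow> 'a::euclidean_space set \<Rightarrow> ('a set \<times> 'a set) set" where
  "k_facets k P = {(D, H). D \<subseteq> P \<and> card D = DIM('a) \<and>
     H \<in> orientations (affine hull D) \<and> card (P \<inter> H) = k}"

(* Meaningful for finite S whose image under f is in general linear position.  The second
   component is the positive side of the affine hull of the image of Q, in the codomain. *)
definition F_k_facets ::
    "('a \<Rightarrow> 'b::euclidean_space) \<Rightarrow> nat \<Rightarrow> 'a set \<Rightarrow> ('a set \<times> 'b set) set" where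
  "F_k_facets f k S = {(Q, H). Q \<subseteq> S \<and> card Q = DIM('b) \<and>
     (f ` Q, H) \<in> k_facets k (f ` S)}"

end

theory Submission
  imports Defs
begin

text \<open>Homogenise \<open>V\<^sub>2\<^sup>2(S)\<close> to a generic vector configuration \<open>A\<close> in \<open>\<real>\<^sup>6\<close>. Squaring the equation of the
  line through two points gives a nonnegative conic, so \<open>A\<close> and all its subsets are 2-neighborly. The
  number of facets of a subset of size \<open>r\<close> is therefore forced: in a generic linear program on the dual
  cone, every face of codimension \<open>j \<le> 2\<close> has exactly one optimal vertex, which yields
  \<open>h\<^sub>0, h\<^sub>1, h\<^sub>2\<close>; reversing the objective yields \<open>h\<^sub>5, h\<^sub>4, h\<^sub>3\<close>, and their sum is
  \<open>(r - 3) (r - 4)\<close>. A facet with \<open>k\<close> points on its positive side is a 0-facet of exactly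
  \<open>(n - 5 - k) choose (r - 5)\<close> subsets of size \<open>r\<close>, so these counts, for all \<open>r\<close>, form a
  triangular linear system that determines the number of \<open>k\<close>-facets.\<close>

section \<open>Linear algebra\<close>

text \<open>The component of \<open>x\<close> orthogonal to \<open>span B\<close> serves as
  \<open>u\<close>.\<close>

lemma separating_functional:
  fixes x :: "'a::euclidean_space"
  assumes "x \<notin> span B"
  obtains u where "\<And>b. b \<in> span B \<Longrightarrow> u \<bullet> b = 0" "u \<bullet> x > 0"
proof -
  obtain y z where y: "y \<in> span B" and z: "\<And>w. w \<in> span B \<Longrightarrow> orthogonal z w" and x: "x = y + z"
    using orthogonal_subspace_decomp_exists[of B x] by blast
  have "z \<noteq> 0"
    using assms x y by auto
  moreover have "z \<bullet> y = 0"
    using z[OF y] by (simp add: orthogonal_def)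
  ultimately have "z \<bullet> x > 0"
    by (simp add: x inner_add_right)
  with z show ?thesis
    using that by (auto simp: orthogonal_def)
qed

lemma eq_0_if_orthogonal_basis:
  fixes w :: "'a::euclidean_space"
  assumes "independent B" "card B = DIM('a)" "\<And>b. b \<in> B \<Longrightarrow> w \<bullet> b = 0"
  shows "w = 0"
proof -
  have "span B = UNIV"
    using assms(1,2) by (metis card_ge_dim_independent dim_UNIV order_refl subset_UNIV top.extremum_uniqueI)
  then have "orthogonal w w"
    using assms(3) by (metis UNIV_I orthogonal_def orthogonal_to_span)
  then show ?thesis
    by (simp add: orthogonal_self)
qed

lemma normal_of_independent:
  fixes F :: "'a::euclidean_space set"
  assumes "independent F" "card F = DIM('a) - 1"
  obtains w where "w \<noteq> 0" "\<And>a. a \<in> F \<Longrightarrow> w \<bullet> a = 0"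
    "\<And>u. (\<And>a. a \<in> F \<Longrightarrow> u \<bullet> a = 0) \<Longrightarrow> \<exists>c. u = c *\<^sub>R w"
proof -
  have "dim F = DIM('a) - 1"
    using assms by (simp add: dim_eq_card_independent)
  then have "dim F < DIM('a)"
    using DIM_positive[where 'a='a] by linarith
  then have "span F \<noteq> UNIV"
    by (metis dim_UNIV dim_span less_irrefl)
  then obtain x where x: "x \<notin> span F"
    by auto
  obtain w where w: "\<And>b. b \<in> span F \<Longrightarrow> w \<bullet> b = 0" "w \<bullet> x > 0"
    using separating_functional[OF x] by blast
  have ind: "independent (insert x F)" "x \<notin> F"
    using x assms(1) span_base by (auto simp: independent_insert)
  have fin: "finite F"
    using assms(1) by (rule independent_imp_finite)
  have card: "card (insert x F) = DIM('a)"
    using ind(2) fin assms(2) DIM_positive[where 'a='a] by simp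
  show ?thesis
  proof
    show "w \<noteq> 0" "\<And>a. a \<in> F \<Longrightarrow> w \<bullet> a = 0"
      using w by (auto simp: span_base)
    fix u assume u: "\<And>a. a \<in> F \<Longrightarrow> u \<bullet> a = 0"
    \<comment> \<open>The multiple of \<open>w\<close> is chosen so that the difference also
      vanishes at \<open>x\<close>, hence on the whole basis \<open>insert x F\<close>.\<close>
    have "u - (u \<bullet> x / (w \<bullet> x)) *\<^sub>R w = 0"
      using u w(2) w(1)[OF span_base]
      by (intro eq_0_if_orthogonal_basis[OF ind(1) card]) (auto simp: inner_diff_left)
    then show "\<exists>c. u = c *\<^sub>R w"
      by (metis eq_iff_diff_eq_0)
  qed
qed

text \<open>Finitely many proper subspaces form a null set, and a nonempty open set is not null.
  Vectors in general position are found this way.\<close>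

lemma open_avoids_lowdim:
  fixes U :: "'a::euclidean_space set"
  assumes "open U" "U \<noteq> {}" "finite \<B>" "\<And>B. B \<in> \<B> \<Longrightarrow> dim B < DIM('a)"
  obtains x where "x \<in> U" "\<And>B. B \<in> \<B> \<Longrightarrow> x \<notin> span B"
proof -
  have "negligible (\<Union>(span ` \<B>))"
    using assms(3,4) by (intro negligible_Union) (auto intro!: negligible_lowdim)
  then have "\<not> U \<subseteq> \<Union>(span ` \<B>)"
    using assms(1,2) negligible_subset open_not_negligible by blast
  then show ?thesis
    using that by blast
qed

lemma inner_attains_inf:
  fixes K :: "'a::real_inner set"
  assumes "compact K" "K \<noteq> {}"
  obtains v where "v \<in> K" "\<And>w. w \<in> K \<Longrightarrow> v \<bullet> x \<le> w \<bullet> x"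
proof -
  have "continuous_on K (\<lambda>w. w \<bullet> x)"
    by (intro continuous_intros)
  then show ?thesis
    using continuous_attains_inf[OF assms] that by blast
qed

text \<open>On a nonempty \<open>K\<close> the values have a positive minimum and the norms a bound
  \<open>M\<close>. By Cauchy-Schwarz, moving \<open>x\<close> by less than the minimum divided by
  \<open>M\<close> keeps all values positive.\<close>

lemma open_positive_on_compact:
  fixes K :: "'a::euclidean_space set"
  assumes "compact K"
  shows "open {x. \<forall>w\<in>K. w \<bullet> x > 0}"
proof (cases "K = {}")
  case False
  show ?thesis
  proof (rule openI, clarify)
    fix x assume x: "\<forall>w\<in>K. w \<bullet> x > 0"
    obtain v where v: "v \<in> K" "\<And>w. w \<in> K \<Longrightarrow> v \<bullet> x \<le> w \<bullet> x"
      using inner_attains_inf[OF assms False] by blast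
    obtain M where M: "M > 0" "\<And>w. w \<in> K \<Longrightarrow> norm w \<le> M"
      using compact_imp_bounded[OF assms] bounded_pos by metis
    have "w \<bullet> y > 0" if y: "y \<in> ball x (v \<bullet> x / M)" and w: "w \<in> K" for w y
    proof -
      have "\<bar>w \<bullet> (x - y)\<bar> \<le> norm w * norm (x - y)"
        by (rule Cauchy_Schwarz_ineq2)
      also have "\<dots> \<le> M * norm (x - y)"
        using M(2)[OF w] by (simp add: mult_right_mono)
      also have "\<dots> < M * (v \<bullet> x / M)"
        using y M(1) by (intro mult_strict_left_mono) (auto simp: dist_norm)
      finally have "\<bar>w \<bullet> (x - y)\<bar> < v \<bullet> x"
        using M(1) by simp
      then show ?thesis
        using v(2)[OF w] by (auto simp: inner_diff_right)
    qed
    moreover have "v \<bullet> x / M > 0"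
      using x v M by simp
    ultimately show "\<exists>e>0. ball x e \<subseteq> {x. \<forall>w\<in>K. w \<bullet> x > 0}"
      by blast
  qed
qed auto

text \<open>A feasible direction allows a short feasible step: slack constraints
  (\<open>f a > 0\<close>) survive by continuity, tight ones because \<open>g a\<close> is
  nonnegative, and there are finitely many of them.\<close>

lemma finite_small_step:
  fixes f g :: "'b \<Rightarrow> real"
  assumes "finite R" "\<And>a. a \<in> R \<Longrightarrow> f a > 0 \<or> f a = 0 \<and> g a \<ge> 0"
  obtains e where "e > 0" "\<And>a. a \<in> R \<Longrightarrow> f a + e * g a \<ge> 0"
proof -
  have "\<forall>\<^sub>F e in at_right 0. f a + e * g a \<ge> 0" if "a \<in> R" for a
  proof (cases "f a > 0")
    case True
    have "((\<lambda>e. f a + e * g a) \<longlongrightarrow> f a + 0 * g a) (at_right 0)"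
      by (intro tendsto_intros)
    with True have "\<forall>\<^sub>F e in at_right 0. f a + e * g a > 0"
      by (simp add: order_tendsto_iff)
    then show ?thesis
      by (rule eventually_mono) simp
  next
    case False
    with assms(2)[OF that] have *: "f a = 0" "g a \<ge> 0"
      by auto
    have "\<forall>\<^sub>F e in at_right (0::real). e > 0"
      by (rule eventually_at_right_less)
    then show ?thesis
      by (rule eventually_mono) (use * in simp)
  qed
  then have "\<forall>\<^sub>F e in at_right 0. \<forall>a\<in>R. f a + e * g a \<ge> 0"
    using assms(1) by (simp add: eventually_ball_finite_distrib)
  then have "\<forall>\<^sub>F e in at_right 0. e > 0 \<and> (\<forall>a\<in>R. f a + e * g a \<ge> 0)"
    by (intro eventually_conj eventually_at_right_less) 
  then obtain e :: real where "e > 0 \<and> (\<forall>a\<in>R. f a + e * g a \<ge> 0)"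
    using eventually_happens' trivial_limit_at_right_real by blast
  then show ?thesis
    using that by blast
qed

section \<open>Generic configurations and linear programming on the dual cone\<close>

text \<open>Smaller subsets are included so that the notion keeps its content for configurations
  with fewer than \<open>DIM('a)\<close> vectors, such as the 5-element samples in dimension
  6.\<close>

definition generic :: "'a::euclidean_space set \<Rightarrow> bool" where
  "generic A \<longleftrightarrow> finite A \<and> (\<forall>B\<subseteq>A. card B \<le> DIM('a) \<longrightarrow> independent B)"

text \<open>The linear counterpart of \<open>orientations\<close>: when \<open>F\<close> spans a
  hyperplane through the origin, an orientation is encoded by its open positive side.\<close>

definition sides :: "'a::euclidean_space set \<Rightarrow> 'a set set" where
  "sides F = {H. \<exists>w. w \<noteq> 0 \<and> (\<forall>a\<in>F. w \<bullet> a = 0) \<and> H = {x. w \<bullet> x > 0}}"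

definition oriented_facets :: "nat \<Rightarrow> 'a::euclidean_space set \<Rightarrow> ('a set \<times> 'a set) set" where
  "oriented_facets k A =
     {(F, H). F \<subseteq> A \<and> card F = DIM('a) - 1 \<and> H \<in> sides F \<and> card (A \<inter> H) = k}"

lemma generic_subset: "generic A \<Longrightarrow> B \<subseteq> A \<Longrightarrow> generic B"
  unfolding generic_def by (meson finite_subset order_trans)

text \<open>The normal is unique up to a nonzero factor, and only the sign of the factor affects the
  side.\<close>

lemma sides_eq:
  fixes F :: "'a::euclidean_space set"
  assumes "independent F" "card F = DIM('a) - 1"
  obtains w where "w \<noteq> 0" "\<And>a. a \<in> F \<Longrightarrow> w \<bullet> a = 0" "sides F = {{x. w \<bullet> x > 0}, {x. w \<bullet> x < 0}}"
    "{x. w \<bullet> x > 0} \<noteq> {x. w \<bullet> x < 0}"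
proof -
  obtain w where w: "w \<noteq> 0" "\<And>a. a \<in> F \<Longrightarrow> w \<bullet> a = 0"
    and u: "\<And>u. (\<And>a. a \<in> F \<Longrightarrow> u \<bullet> a = 0) \<Longrightarrow> \<exists>c. u = c *\<^sub>R w"
    using normal_of_independent[OF assms] by blast
  show ?thesis
  proof
    show "sides F = {{x. w \<bullet> x > 0}, {x. w \<bullet> x < 0}}"
    proof (intro equalityI subsetI)
      fix H assume "H \<in> sides F"
      then obtain v where v: "v \<noteq> 0" "\<forall>a\<in>F. v \<bullet> a = 0" "H = {x. v \<bullet> x > 0}"
        by (auto simp: sides_def)
      then obtain c where c: "v = c *\<^sub>R w"
        using u by blast
      then have "c \<noteq> 0"
        using v by auto
      then show "H \<in> {{x. w \<bullet> x > 0}, {x. w \<bullet> x < 0}}"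
        using v(3) by (cases "c > 0") (auto simp: c zero_less_mult_iff)
    next
      fix H assume "H \<in> {{x. w \<bullet> x > 0}, {x. w \<bullet> x < 0}}"
      then have "H = {x. w \<bullet> x > 0} \<or> H = {x. (-w) \<bullet> x > 0}"
        by auto
      moreover have "-w \<noteq> 0" "\<forall>a\<in>F. (-w) \<bullet> a = 0" "\<forall>a\<in>F. w \<bullet> a = 0"
        using w by auto
      ultimately show "H \<in> sides F"
        unfolding sides_def using w(1) by blast
    qed
    have "w \<bullet> w > 0"
      using w by simp
    then show "{x. w \<bullet> x > 0} \<noteq> {x. w \<bullet> x < 0}"
      using less_asym by blast
  qed (use w in auto)
qed

text \<open>Otherwise \<open>w\<close> would be orthogonal to the basis
  \<open>insert x F\<close>.\<close>

lemma generic_sides_nonzero: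
  fixes A :: "'a::euclidean_space set"
  assumes "generic A" "F \<subseteq> A" "card F = DIM('a) - 1" "w \<noteq> 0" "\<And>a. a \<in> F \<Longrightarrow> w \<bullet> a = 0"
    "x \<in> A - F"
  shows "w \<bullet> x \<noteq> 0"
proof
  assume "w \<bullet> x = 0"
  moreover have "finite F"
    using assms by (meson generic_def finite_subset)
  ultimately have "w = 0"
    using assms DIM_positive[where 'a='a]
    by (intro eq_0_if_orthogonal_basis[of "insert x F"]) (auto simp: generic_def)
  with assms(4) show False
    by simp
qed

text \<open>For generic \<open>R\<close> with at least \<open>DIM('a)\<close> elements these are the
  facets of the cone spanned by \<open>R\<close>. Dually, \<open>w\<close> spans an extreme ray of
  the dual cone and \<open>F\<close> is the set of its tight constraints.\<close>

definition supporting_facets :: "'a::euclidean_space set \<Rightarrow> 'a set set" where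
  "supporting_facets R = {F. F \<subseteq> R \<and> card F = DIM('a) - 1 \<and>
     (\<exists>w. (\<forall>a\<in>F. w \<bullet> a = 0) \<and> (\<forall>a\<in>R - F. w \<bullet> a > 0))}"

lemma closed_dual_cone: "closed {w :: 'a::real_inner. \<forall>a\<in>B. w \<bullet> a \<ge> 0}"
proof -
  have "{w. \<forall>a\<in>B. w \<bullet> a \<ge> 0} = (\<Inter>a\<in>B. {w. a \<bullet> w \<ge> 0})"
    by (auto simp: inner_commute)
  then show ?thesis
    by (auto intro: closed_halfspace_ge)
qed

lemma closed_orthogonal: "closed {w :: 'a::real_inner. \<forall>a\<in>B. w \<bullet> a = 0}"
proof -
  have "{w. \<forall>a\<in>B. w \<bullet> a = 0} = (\<Inter>a\<in>B. {w. a \<bullet> w = 0})"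
    by (auto simp: inner_commute)
  then show ?thesis
    by (auto intro: closed_hyperplane)
qed

text \<open>A generic linear program. By \<open>pos\<close>, the equation
  \<open>w \<bullet> l = 1\<close> cuts a bounded section out of the dual cone of \<open>R\<close>;
  its vertices correspond to \<open>supporting_facets R\<close>, and \<open>c\<close> is the
  objective. General position makes \<open>l\<close> complete every facet to a basis and keeps
  \<open>c\<close> from being constant along an edge.\<close>

locale sweep =
  fixes R :: "'a::euclidean_space set" and l c :: 'a
  assumes gen: "generic R" and card_R: "DIM('a) \<le> card R" and dim2: "2 \<le> DIM('a)"
    and pos: "\<And>w. w \<noteq> 0 \<Longrightarrow> (\<And>a. a \<in> R \<Longrightarrow> w \<bullet> a \<ge> 0) \<Longrightarrow> w \<bullet> l > 0"
    and l: "\<And>F. F \<subseteq> R \<Longrightarrow> card F = DIM('a) - 1 \<Longrightarrow> l \<notin> span F"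
    and c: "\<And>F. F \<subseteq> R \<Longrightarrow> card F = DIM('a) - 2 \<Longrightarrow> c \<notin> span (insert l F)"
begin

text \<open>Writing \<open>c - \<mu> l = (\<Sum>i\<in>F. t i *\<^sub>R i)\<close>, this is the set of all \<open>i\<close> with \<open>t i > 0\<close>.\<close>

definition ascents :: "'a set \<Rightarrow> 'a set" where
  "ascents F = {i \<in> F. \<exists>u. u \<bullet> l = 0 \<and> (\<forall>a\<in>F - {i}. u \<bullet> a = 0) \<and> u \<bullet> i > 0 \<and> u \<bullet> c > 0}"

lemma finite_R: "finite R"
  using gen by (simp add: generic_def)

lemma independent_facet: "F \<subseteq> R \<Longrightarrow> card F \<le> DIM('a) \<Longrightarrow> independent F"
  using gen by (simp add: generic_def)

lemma independent_insert_l: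
  assumes "F \<subseteq> R" "card F = DIM('a) - 1"
  shows "independent (insert l F)" "l \<notin> F" "card (insert l F) = DIM('a)"
proof -
  have "l \<notin> span F"
    using l assms by blast
  then show "l \<notin> F"
    using span_base by blast
  then show "independent (insert l F)"
    using independent_facet[of F] assms \<open>l \<notin> span F\<close> by (simp add: independent_insert)
  show "card (insert l F) = DIM('a)"
    using assms \<open>l \<notin> F\<close> finite_subset[OF assms(1) finite_R] dim2 by simp
qed

text \<open>Releasing the constraint \<open>i\<close> at the vertex of \<open>F\<close>, while
  keeping the other tight constraints and the normalisation by \<open>l\<close>, leaves a direction
  to move in, because \<open>insert l F\<close> is a basis.\<close>

lemma edge_direction:
  assumes "F \<subseteq> R" "card F = DIM('a) - 1" "i \<in> F"
  obtains u where "u \<bullet> l = 0" "\<And>a. a \<in> F - {i} \<Longrightarrow> u \<bullet> a = 0" "u \<bullet> i = 1"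
proof -
  have "i \<notin> span (insert l F - {i})"
    using independent_insert_l[OF assms(1,2)] assms(3) unfolding dependent_def by blast
  moreover have "insert l F - {i} = insert l (F - {i})"
    using independent_insert_l(2)[OF assms(1,2)] assms(3) by auto
  ultimately obtain u where u: "\<And>b. b \<in> span (insert l (F - {i})) \<Longrightarrow> u \<bullet> b = 0" "u \<bullet> i > 0"
    using separating_functional by metis
  show ?thesis
    using u span_base[of _ "insert l (F - {i})"]
    by (intro that[of "(1 / (u \<bullet> i)) *\<^sub>R u"]) auto
qed

text \<open>By the choice of \<open>c\<close>, the vectors \<open>c\<close>, \<open>l\<close> and
  those of \<open>F - {i}\<close> form a basis, so \<open>u \<bullet> c = 0\<close> would force
  \<open>u = 0\<close>.\<close>

lemma edge_direction_nonzero: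
  assumes F: "F \<subseteq> R" "card F = DIM('a) - 1" "i \<in> F"
    and u: "u \<bullet> l = 0" "\<And>a. a \<in> F - {i} \<Longrightarrow> u \<bullet> a = 0" "u \<bullet> i \<noteq> 0"
  shows "u \<bullet> c \<noteq> 0"
proof
  assume 0: "u \<bullet> c = 0"
  have fin: "finite F"
    using F(1) finite_R by (rule finite_subset)
  have card: "card (F - {i}) = DIM('a) - 2"
    using F fin by simp
  have sub: "insert l (F - {i}) \<subseteq> insert l F"
    by auto
  have ind: "independent (insert l (F - {i}))"
    using independent_insert_l(1)[OF F(1,2)] independent_mono sub by blast
  have notin: "c \<notin> span (insert l (F - {i}))"
    using c[OF _ card] F by blast
  have "u = 0"
  proof (rule eq_0_if_orthogonal_basis)
    show "independent (insert c (insert l (F - {i})))"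
      using ind notin by (simp add: independent_insert)
    have "c \<notin> insert l (F - {i})"
      using notin span_base[of c "insert l (F - {i})"] by argo
    then show "card (insert c (insert l (F - {i}))) = DIM('a)"
      using card fin dim2 independent_insert_l(2)[OF F(1,2)] by auto
  qed (use u 0 in auto)
  with u(3) show False
    by simp
qed

text \<open>The conditions fix \<open>u\<close> up to a positive factor, so any such edge direction
  decides membership.\<close>

lemma mem_ascents_iff:
  assumes F: "F \<subseteq> R" "card F = DIM('a) - 1" "i \<in> F"
    and u: "u \<bullet> l = 0" "\<And>a. a \<in> F - {i} \<Longrightarrow> u \<bullet> a = 0" "u \<bullet> i > 0"
  shows "i \<in> ascents F \<longleftrightarrow> u \<bullet> c > 0"
proof
  assume "i \<in> ascents F"
  then obtain v where v: "v \<bullet> l = 0" "\<forall>a\<in>F - {i}. v \<bullet> a = 0" "v \<bullet> i > 0" "v \<bullet> c > 0"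
    by (auto simp: ascents_def)
  have "u - (u \<bullet> i / (v \<bullet> i)) *\<^sub>R v = 0"
  proof (rule eq_0_if_orthogonal_basis)
    fix b assume "b \<in> insert l F"
    then consider "b = l" | "b = i" | "b \<in> F - {i}"
      by auto
    then show "(u - (u \<bullet> i / (v \<bullet> i)) *\<^sub>R v) \<bullet> b = 0"
      using u v by (cases) (auto simp: inner_diff_left)
  qed (use independent_insert_l[OF F(1,2)] in auto)
  then have "u = (u \<bullet> i / (v \<bullet> i)) *\<^sub>R v"
    by simp
  then have "u \<bullet> c = (u \<bullet> i / (v \<bullet> i)) * (v \<bullet> c)"
    by (metis inner_scaleR_left)
  then show "u \<bullet> c > 0"
    using u v by simp
qed (use u F in \<open>auto simp: ascents_def\<close>)

lemma facet_normal:
  assumes "F \<in> supporting_facets R"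
  obtains w where "w \<bullet> l = 1" "\<And>a. a \<in> F \<Longrightarrow> w \<bullet> a = 0" "\<And>a. a \<in> R - F \<Longrightarrow> w \<bullet> a > 0"
proof -
  obtain w where F: "F \<subseteq> R" "card F = DIM('a) - 1"
    and w: "\<And>a. a \<in> F \<Longrightarrow> w \<bullet> a = 0" "\<And>a. a \<in> R - F \<Longrightarrow> w \<bullet> a > 0"
    using assms by (auto simp: supporting_facets_def)
  have "F \<noteq> R"
    using F card_R dim2 by auto
  then have "w \<noteq> 0"
    using w(2) F(1) by fastforce
  moreover have "w \<bullet> a \<ge> 0" if "a \<in> R" for a
    using w[of a] that by (cases "a \<in> F") auto
  ultimately have "w \<bullet> l > 0"
    using pos by blast
  then show ?thesis
    using w by (intro that[of "(1 / (w \<bullet> l)) *\<^sub>R w"]) auto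
qed

text \<open>Weak duality; \<open>d\<close> stands for the difference between a feasible point and the vertex of \<open>F\<close>.\<close>

lemma optimal_vertex:
  assumes F: "F \<subseteq> R" "card F = DIM('a) - 1" "F - G \<subseteq> ascents F"
    and d: "d \<bullet> l = 0" "\<And>a. a \<in> F \<inter> G \<Longrightarrow> d \<bullet> a = 0" "\<And>a. a \<in> F \<Longrightarrow> d \<bullet> a \<ge> 0"
  shows "d \<bullet> c \<ge> 0" "d \<bullet> c = 0 \<Longrightarrow> d = 0"
proof -
  have "\<exists>u. u \<bullet> l = 0 \<and> (\<forall>a\<in>F - {i}. u \<bullet> a = 0) \<and> u \<bullet> i = 1" if "i \<in> F" for i
    using edge_direction[OF F(1,2) that] by metis
  then obtain u where u: "\<And>i. i \<in> F \<Longrightarrow> u i \<bullet> l = 0"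
      "\<And>i a. i \<in> F \<Longrightarrow> a \<in> F - {i} \<Longrightarrow> u i \<bullet> a = 0" "\<And>i. i \<in> F \<Longrightarrow> u i \<bullet> i = 1"
    by metis
  have fin: "finite F"
    using F(1) finite_R by (rule finite_subset)
  \<comment> \<open>The edge directions \<open>u i\<close> are dual to the elements of
    \<open>F\<close>; as \<open>d\<close> is orthogonal to \<open>l\<close>, it is their combination
    with coefficients \<open>d \<bullet> i\<close>.\<close>
  have "d - (\<Sum>i\<in>F. (d \<bullet> i) *\<^sub>R u i) = 0"
  proof (rule eq_0_if_orthogonal_basis)
    fix b assume b: "b \<in> insert l F"
    have "(\<Sum>i\<in>F. (d \<bullet> i) * (u i \<bullet> b)) = (\<Sum>i\<in>F. if i = b then d \<bullet> b else 0)" if "b \<in> F"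
      using u that by (intro sum.cong) auto
    then show "(d - (\<Sum>i\<in>F. (d \<bullet> i) *\<^sub>R u i)) \<bullet> b = 0"
      using b d(1) u(1) fin by (auto simp: inner_diff_left inner_sum_left)
  qed (use independent_insert_l[OF F(1,2)] in auto)
  then have d_eq: "d = (\<Sum>i\<in>F. (d \<bullet> i) *\<^sub>R u i)"
    by simp
  have c_eq: "d \<bullet> c = (\<Sum>i\<in>F. (d \<bullet> i) * (u i \<bullet> c))"
    by (subst d_eq) (simp add: inner_sum_left)
  have uc: "u i \<bullet> c > 0" if "i \<in> F - G" for i
    using mem_ascents_iff[OF F(1,2), of i "u i"] that u F(3) by force
  have nonneg: "(d \<bullet> i) * (u i \<bullet> c) \<ge> 0" if "i \<in> F" for i
    using that uc[of i] d by (cases "i \<in> G") auto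
  show "d \<bullet> c \<ge> 0"
    unfolding c_eq using nonneg by (rule sum_nonneg)
  show "d = 0" if "d \<bullet> c = 0"
  proof -
    have "(d \<bullet> i) * (u i \<bullet> c) = 0" if "i \<in> F" for i
      using \<open>d \<bullet> c = 0\<close> that nonneg fin unfolding c_eq by (simp add: sum_nonneg_eq_0_iff)
    then have "d \<bullet> i = 0" if "i \<in> F" for i
      using that uc[of i] d(2)[of i] by fastforce
    then show ?thesis
      using d_eq by simp
  qed
qed

text \<open>Both normals minimise \<open>c\<close> over the face of the section on which
  \<open>G\<close> vanishes. The minimiser is unique by \<open>optimal_vertex\<close>, and a normal
  determines its facet as its zero set in \<open>R\<close>.\<close>

lemma facet_above_unique:
  assumes F: "F \<in> supporting_facets R" "G \<subseteq> F" "F - G \<subseteq> ascents F"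
    and F': "F' \<in> supporting_facets R" "G \<subseteq> F'" "F' - G \<subseteq> ascents F'"
  shows "F = F'"
proof -
  obtain w where w: "w \<bullet> l = 1" "\<And>a. a \<in> F \<Longrightarrow> w \<bullet> a = 0" "\<And>a. a \<in> R - F \<Longrightarrow> w \<bullet> a > 0"
    using facet_normal[OF F(1)] by metis
  obtain w' where w': "w' \<bullet> l = 1" "\<And>a. a \<in> F' \<Longrightarrow> w' \<bullet> a = 0" "\<And>a. a \<in> R - F' \<Longrightarrow> w' \<bullet> a > 0"
    using facet_normal[OF F'(1)] by metis
  have sub: "F \<subseteq> R" "card F = DIM('a) - 1" "F' \<subseteq> R" "card F' = DIM('a) - 1"
    using F F' by (auto simp: supporting_facets_def)
  have w0: "w \<bullet> a \<ge> 0" "w' \<bullet> a \<ge> 0" if "a \<in> R" for a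
    using that w(2,3)[of a] w'(2,3)[of a] by force+
  have "(w' - w) \<bullet> c \<ge> 0" and eq: "(w' - w) \<bullet> c = 0 \<Longrightarrow> w' - w = 0"
    by (rule optimal_vertex[OF sub(1,2) F(3)];
        use w w' w0 F F' sub in \<open>auto simp: inner_diff_left\<close>)+
  moreover have "(w - w') \<bullet> c \<ge> 0"
    by (rule optimal_vertex[OF sub(3,4) F'(3)];
        use w w' w0 F F' sub in \<open>auto simp: inner_diff_left\<close>)
  ultimately have "w = w'"
    by (simp add: inner_diff_left)
  then have "F \<subseteq> F'"
    using w(2) w'(3) sub by fastforce
  then show ?thesis
    using sub finite_R by (metis card_subset_eq finite_subset)
qed

text \<open>The minimum of \<open>l\<close> over the unit vectors of the dual cone is positive, and
  its inverse bounds the norm on the section. If there are no such unit vectors, the section is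
  empty.\<close>

lemma compact_dual_section:
  "compact {w. w \<bullet> l = 1 \<and> (\<forall>a\<in>R. w \<bullet> a \<ge> 0) \<and> (\<forall>a\<in>G. w \<bullet> a = 0)}" (is "compact ?K")
proof -
  note cl = closed_dual_cone closed_orthogonal
  have "?K = {w. l \<bullet> w = 1} \<inter> {w. \<forall>a\<in>R. w \<bullet> a \<ge> 0} \<inter> {w. \<forall>a\<in>G. w \<bullet> a = 0}"
    by (auto simp: inner_commute)
  then have closed: "closed ?K"
    using cl by (auto intro!: closed_Int closed_hyperplane)
  let ?C = "sphere 0 1 \<inter> {w. \<forall>a\<in>R. w \<bullet> a \<ge> 0}"
  have "bounded ?K"
  proof (cases "?C = {}")
    case True
    have "?K \<subseteq> {}"
    proof
      fix w assume w: "w \<in> ?K"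
      then have "w \<noteq> 0"
        by auto
      then have "(1 / norm w) *\<^sub>R w \<in> ?C"
        using w by auto
      with True show "w \<in> {}"
        by auto
    qed
    then show ?thesis
      using bounded_subset[OF bounded_empty] by blast
  next
    case False
    have "compact ?C"
      by (intro compact_Int_closed compact_sphere cl(1))
    then obtain v where v: "v \<in> ?C" "\<And>w. w \<in> ?C \<Longrightarrow> v \<bullet> l \<le> w \<bullet> l"
      using inner_attains_inf[OF _ False, of l] by blast
    have "v \<bullet> l > 0"
      using v(1) by (intro pos) auto
    have "norm w \<le> 1 / (v \<bullet> l)" if w: "w \<in> ?K" for w
    proof -
      have "w \<noteq> 0"
        using w by auto
      then have "(1 / norm w) *\<^sub>R w \<in> ?C"
        using w by auto
      then have "v \<bullet> l \<le> ((1 / norm w) *\<^sub>R w) \<bullet> l"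
        by (rule v(2))
      also have "\<dots> = 1 / norm w"
        using w by simp
      finally show ?thesis
        using \<open>w \<noteq> 0\<close> \<open>v \<bullet> l > 0\<close> by (simp add: field_simps)
    qed
    then show ?thesis
      using bounded_iff by blast
  qed
  with closed show ?thesis
    by (simp add: compact_eq_bounded_closed)
qed

text \<open>A minimiser of \<open>c\<close> over the face of the section where \<open>G\<close>
  vanishes exists by compactness. Its tight constraints form the required facet: nondegeneracy gives
  the right cardinality, and optimality makes every edge leaving \<open>G\<close>'s other tight
  constraints ascend.\<close>

lemma facet_above_exists:
  assumes G: "G \<subseteq> R" and w0: "w0 \<noteq> 0" "\<And>a. a \<in> G \<Longrightarrow> w0 \<bullet> a = 0" "\<And>a. a \<in> R \<Longrightarrow> w0 \<bullet> a \<ge> 0"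
  shows "\<exists>F \<in> supporting_facets R. G \<subseteq> F \<and> F - G \<subseteq> ascents F"
proof -
  define K where "K = {w. w \<bullet> l = 1 \<and> (\<forall>a\<in>R. w \<bullet> a \<ge> 0) \<and> (\<forall>a\<in>G. w \<bullet> a = 0)}"
  have "w0 \<bullet> l > 0"
    using w0 by (intro pos) auto
  then have "(1 / (w0 \<bullet> l)) *\<^sub>R w0 \<in> K"
    using w0 by (auto simp: K_def)
  moreover have "compact K"
    unfolding K_def by (rule compact_dual_section)
  ultimately obtain w where w: "w \<in> K" "\<And>v. v \<in> K \<Longrightarrow> w \<bullet> c \<le> v \<bullet> c"
    using inner_attains_inf[of K c] by blast
  define F where "F = {a \<in> R. w \<bullet> a = 0}"
  have FR: "F \<subseteq> R" and GF: "G \<subseteq> F"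
    using w(1) G by (auto simp: F_def K_def)
  have fin: "finite F"
    using FR finite_R by (rule finite_subset)
  have wpos: "w \<bullet> a > 0" if "a \<in> R - F" for a
    using that w(1) by (auto simp: F_def K_def less_le)
  have "w \<noteq> 0"
    using w(1) by (auto simp: K_def)
  \<comment> \<open>First-order optimality: no feasible direction at the minimiser decreases the
    objective.\<close>
  have opt: "u \<bullet> c \<ge> 0"
    if u: "u \<bullet> l = 0" "\<And>a. a \<in> G \<Longrightarrow> u \<bullet> a = 0" "\<And>a. a \<in> F \<Longrightarrow> u \<bullet> a \<ge> 0" for u
  proof -
    obtain e where e: "e > 0" "\<And>a. a \<in> R \<Longrightarrow> w \<bullet> a + e * (u \<bullet> a) \<ge> 0"
      by (rule finite_small_step[OF finite_R, of "\<lambda>a. w \<bullet> a" "\<lambda>a. u \<bullet> a"])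
        (use u wpos F_def in auto)
    have "w + e *\<^sub>R u \<in> K"
      using w(1) u e by (auto simp: K_def inner_add_left)
    then have "w \<bullet> c \<le> (w + e *\<^sub>R u) \<bullet> c"
      by (rule w(2))
    then show ?thesis
      using e(1) by (simp add: inner_add_left zero_le_mult_iff)
  qed
  have "card F < DIM('a)"
  proof (rule ccontr)
    assume "\<not> card F < DIM('a)"
    then obtain B where B: "B \<subseteq> F" "card B = DIM('a)"
      by (metis not_less obtain_subset_with_card_n)
    then have "w = 0"
      using FR by (intro eq_0_if_orthogonal_basis[of B] independent_facet) (auto simp: F_def)
    with \<open>w \<noteq> 0\<close> show False
      by simp
  qed
  \<comment> \<open>With too few tight constraints, some direction \<open>u\<close> respecting all
    of them and the normalisation increases \<open>c\<close>; then \<open>- u\<close> is feasible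
    too and decreases it.\<close>
  moreover have "\<not> card F \<le> DIM('a) - 2"
  proof
    assume "card F \<le> DIM('a) - 2"
    then obtain B where B: "F \<subseteq> B" "B \<subseteq> R" "card B = DIM('a) - 2"
      using exists_subset_between[of F "DIM('a) - 2" R] card_R FR finite_R
      by (metis diff_le_self order_trans)
    then obtain u where u: "\<And>b. b \<in> span (insert l B) \<Longrightarrow> u \<bullet> b = 0" "u \<bullet> c > 0"
      using separating_functional[OF c[OF B(2,3)]] by blast
    have 0: "u \<bullet> a = 0" if "a \<in> insert l F" for a
      using that B by (intro u(1) span_base) auto
    have "(- u) \<bullet> c \<ge> 0"
      by (rule opt) (use 0 GF in auto)
    with u(2) show False
      by simp
  qed
  ultimately have card: "card F = DIM('a) - 1"
    by linarith
  have "F \<in> supporting_facets R"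
    using FR card wpos F_def by (auto simp: supporting_facets_def intro!: exI[of _ w])
  moreover have "F - G \<subseteq> ascents F"
  proof
    fix i assume i: "i \<in> F - G"
    obtain u where u: "u \<bullet> l = 0" "\<And>a. a \<in> F - {i} \<Longrightarrow> u \<bullet> a = 0" "u \<bullet> i = 1"
      using edge_direction[OF FR card, of i] i by blast
    have "u \<bullet> c \<ge> 0"
    proof (rule opt)
      fix a assume "a \<in> F"
      then show "u \<bullet> a \<ge> 0"
        using u by (cases "a = i") auto
    qed (use u GF i in auto)
    moreover have "u \<bullet> c \<noteq> 0"
      by (rule edge_direction_nonzero[OF FR card]) (use u i in auto)
    ultimately show "i \<in> ascents F"
      by (subst mem_ascents_iff[OF FR card, of i u]) (use u i in auto)
  qed
  ultimately show ?thesis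
    using GF by blast
qed

lemma finite_supporting_facets: "finite (supporting_facets R)"
  by (rule finite_subset[of _ "Pow R"]) (auto simp: supporting_facets_def finite_R)

end

section \<open>Reversal and existence of generic linear programs\<close>

lemma sweep_uminus:
  assumes "sweep R l c"
  shows "sweep R l (- c)"
  using assms unfolding sweep_def by (metis span_neg minus_minus)

text \<open>The objective changes strictly along every edge, so negating it exchanges ascending and
  descending edges.\<close>

lemma ascents_uminus:
  fixes R :: "'a::euclidean_space set"
  assumes "sweep R l c" "F \<subseteq> R" "card F = DIM('a) - 1"
  shows "sweep.ascents l (- c) F = F - sweep.ascents l c F"
proof -
  interpret A: sweep R l c
    by fact
  interpret B: sweep R l "- c"
    using assms(1) by (rule sweep_uminus)
  have "i \<in> B.ascents F \<longleftrightarrow> i \<notin> A.ascents F" if i: "i \<in> F" for i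
  proof -
    obtain u where u: "u \<bullet> l = 0" "\<And>a. a \<in> F - {i} \<Longrightarrow> u \<bullet> a = 0" "u \<bullet> i = 1"
      using A.edge_direction[OF assms(2,3) i] by blast
    have "u \<bullet> c \<noteq> 0"
      by (rule A.edge_direction_nonzero[OF assms(2,3) i]) (use u in auto)
    then show ?thesis
      using A.mem_ascents_iff[OF assms(2,3) i, of u] B.mem_ascents_iff[OF assms(2,3) i, of u] u
      by auto
  qed
  moreover have "A.ascents F \<subseteq> F" "B.ascents F \<subseteq> F"
    by (auto simp: A.ascents_def B.ascents_def)
  ultimately show ?thesis
    by blast
qed

text \<open>The vectors \<open>l\<close> that are positive on the dual cone form an open set
  containing the sum of \<open>R\<close>, so one of them avoids finitely many hyperplanes. Then
  \<open>c\<close> is chosen off finitely many proper subspaces depending on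
  \<open>l\<close>.\<close>

lemma sweep_exists:
  fixes R :: "'a::euclidean_space set"
  assumes "generic R" "DIM('a) \<le> card R" "2 \<le> DIM('a)"
  obtains l c where "sweep R l c"
proof -
  have fin: "finite R"
    using assms by (simp add: generic_def)
  define U where "U = {x. \<forall>w \<in> sphere 0 1 \<inter> {w. \<forall>a\<in>R. w \<bullet> a \<ge> 0}. w \<bullet> x > 0}"
  have "open U"
    unfolding U_def by (intro open_positive_on_compact compact_Int_closed closed_dual_cone) auto
  obtain B where B: "B \<subseteq> R" "card B = DIM('a)"
    using assms(2) by (metis obtain_subset_with_card_n)
  have "(\<Sum>a\<in>R. a) \<in> U"
    unfolding U_def
  proof clarify
    fix w :: 'a assume w: "w \<in> sphere 0 1" "\<forall>a\<in>R. 0 \<le> w \<bullet> a"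
    \<comment> \<open>A zero sum of nonnegative terms would make \<open>w\<close> orthogonal to all
      of \<open>R\<close>, which contains a basis.\<close>
    have "(\<Sum>a\<in>R. w \<bullet> a) \<noteq> 0"
    proof
      assume "(\<Sum>a\<in>R. w \<bullet> a) = 0"
      then have "\<forall>a\<in>R. w \<bullet> a = 0"
        using w fin by (simp add: sum_nonneg_eq_0_iff)
      then have "w = 0"
        using B assms(1) by (intro eq_0_if_orthogonal_basis[of B]) (auto simp: generic_def)
      with w(1) show False
        by simp
    qed
    moreover have "(\<Sum>a\<in>R. w \<bullet> a) \<ge> 0"
      using w by (simp add: sum_nonneg)
    ultimately show "w \<bullet> (\<Sum>a\<in>R. a) > 0"
      by (simp add: inner_sum_right)
  qed
  then have "U \<noteq> {}"
    by blast
  have dim: "dim F < DIM('a)" if "F \<subseteq> R" "card F = DIM('a) - 1" for F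
    using dim_le_card'[OF finite_subset[OF that(1) fin]] that(2) assms(3) by linarith
  obtain l where l: "l \<in> U" "\<And>F. F \<in> {F. F \<subseteq> R \<and> card F = DIM('a) - 1} \<Longrightarrow> l \<notin> span F"
    by (rule open_avoids_lowdim[OF \<open>open U\<close> \<open>U \<noteq> {}\<close>, of "{F. F \<subseteq> R \<and> card F = DIM('a) - 1}"])
      (use fin dim in auto)
  have dim': "dim (insert l F) < DIM('a)" if "F \<subseteq> R" "card F = DIM('a) - 2" for F
  proof -
    have "finite F"
      using that fin finite_subset by blast
    then have "dim (insert l F) \<le> card (insert l F)"
      by (intro dim_le_card') auto
    also have "\<dots> \<le> Suc (card F)"
      by (rule card_insert_le_m1) auto
    finally show ?thesis
      using that(2) assms(3) by linarith
  qed
  obtain c where c: "\<And>B. B \<in> insert l ` {F. F \<subseteq> R \<and> card F = DIM('a) - 2} \<Longrightarrow> c \<notin> span B"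
    by (rule open_avoids_lowdim[OF open_UNIV UNIV_not_empty,
          of "insert l ` {F. F \<subseteq> R \<and> card F = DIM('a) - 2}"])
      (use fin dim' in auto)
  have "w \<bullet> l > 0" if "w \<noteq> 0" "\<And>a. a \<in> R \<Longrightarrow> w \<bullet> a \<ge> 0" for w
  proof -
    have "(1 / norm w) *\<^sub>R w \<in> sphere 0 1 \<inter> {w. \<forall>a\<in>R. w \<bullet> a \<ge> 0}"
      using that by auto
    then have "((1 / norm w) *\<^sub>R w) \<bullet> l > 0"
      using l(1) unfolding U_def by blast
    then show ?thesis
      using that(1) by (simp add: zero_less_divide_iff)
  qed
  then have "sweep R l c"
    using assms l(2) c by unfold_locales auto
  then show ?thesis
    by (rule that)
qed

section \<open>Facets of neighborly configurations\<close>

text \<open>The sets \<open>G\<close> correspond to their parts outside \<open>N\<close>. The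
  conditional guards against truncated subtraction, which would turn the binomial into 1 when
  \<open>card N > j\<close>.\<close>

lemma card_subsets_between:
  assumes "finite F" "N \<subseteq> F"
  shows "card {G. N \<subseteq> G \<and> G \<subseteq> F \<and> card G = j} =
    (if card N \<le> j then (card F - card N) choose (j - card N) else 0)"
proof (cases "card N \<le> j")
  case True
  have finN: "finite N"
    using assms finite_subset by blast
  have "bij_betw (\<lambda>G. N \<union> G) {G. G \<subseteq> F - N \<and> card G = j - card N}
      {G. N \<subseteq> G \<and> G \<subseteq> F \<and> card G = j}"
  proof (rule bij_betwI[where g = "\<lambda>G. G - N"])
    show "(\<lambda>G. N \<union> G) \<in> {G. G \<subseteq> F - N \<and> card G = j - card N} \<rightarrow> {G. N \<subseteq> G \<and> G \<subseteq> F \<and> card G = j}"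
    proof
      fix G assume G: "G \<in> {G. G \<subseteq> F - N \<and> card G = j - card N}"
      then have "finite G" "N \<inter> G = {}"
        using assms by (auto intro: finite_subset)
      then have "card (N \<union> G) = j"
        using G True finN by (simp add: card_Un_disjoint)
      then show "N \<union> G \<in> {G. N \<subseteq> G \<and> G \<subseteq> F \<and> card G = j}"
        using G assms(2) by auto
    qed
    show "(\<lambda>G. G - N) \<in> {G. N \<subseteq> G \<and> G \<subseteq> F \<and> card G = j} \<rightarrow> {G. G \<subseteq> F - N \<and> card G = j - card N}"
      using finN by (auto simp: card_Diff_subset)
  qed auto
  then have "card {G. N \<subseteq> G \<and> G \<subseteq> F \<and> card G = j} = card {G. G \<subseteq> F - N \<and> card G = j - card N}"
    by (simp add: bij_betw_same_card)
  also have "\<dots> = (card F - card N) choose (j - card N)"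
    using assms finN by (simp add: n_subsets card_Diff_subset)
  finally show ?thesis
    using True by simp
next
  case False
  then have "{G. N \<subseteq> G \<and> G \<subseteq> F \<and> card G = j} = {}"
    using assms by (auto dest: card_mono[rotated] intro: finite_subset)
  then show ?thesis
    using False by (simp only: card.empty if_False)
qed

text \<open>The functional may vanish on further elements of \<open>A\<close>, so \<open>G\<close>
  only has to lie in some proper face. For \<open>j = 0\<close> this says that \<open>A\<close> lies
  in a closed half-space.\<close>

definition j_neighborly :: "nat \<Rightarrow> 'a::euclidean_space set \<Rightarrow> bool" where
  "j_neighborly j A \<longleftrightarrow> (\<forall>G\<subseteq>A. card G = j \<longrightarrow>
     (\<exists>w. w \<noteq> 0 \<and> (\<forall>a\<in>G. w \<bullet> a = 0) \<and> (\<forall>a\<in>A. w \<bullet> a \<ge> 0)))"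

lemma j_neighborly_subset: "j_neighborly j A \<Longrightarrow> B \<subseteq> A \<Longrightarrow> j_neighborly j B"
  unfolding j_neighborly_def by (metis (no_types, lifting) subset_trans subsetD)

text \<open>Every \<open>j\<close>-subset \<open>G\<close> lies on a face with exactly one optimal
  vertex; \<open>G\<close> is counted at the facet \<open>F\<close> of that vertex, where it must
  contain all descents of \<open>F\<close>.\<close>

lemma (in sweep) sum_facets_above:
  assumes "j_neighborly j R"
  shows "(\<Sum>F\<in>supporting_facets R. card {G. F - ascents F \<subseteq> G \<and> G \<subseteq> F \<and> card G = j}) =
    card R choose j"
proof -
  let ?S = "\<lambda>F. {G. F - ascents F \<subseteq> G \<and> G \<subseteq> F \<and> card G = j}"
  have "{G. G \<subseteq> R \<and> card G = j} = (\<Union>F\<in>supporting_facets R. ?S F)"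
  proof (intro equalityI subsetI)
    fix G assume G: "G \<in> {G. G \<subseteq> R \<and> card G = j}"
    then obtain w where w: "w \<noteq> 0" "\<forall>a\<in>G. w \<bullet> a = 0" "\<forall>a\<in>R. w \<bullet> a \<ge> 0"
      using assms unfolding j_neighborly_def by blast
    then obtain F where "F \<in> supporting_facets R" "G \<subseteq> F" "F - G \<subseteq> ascents F"
      using facet_above_exists[of G w] G by blast
    then show "G \<in> (\<Union>F\<in>supporting_facets R. ?S F)"
      using G by blast
  qed (auto simp: supporting_facets_def)
  moreover have "card (\<Union>F\<in>supporting_facets R. ?S F) = (\<Sum>F\<in>supporting_facets R. card (?S F))"
  proof (rule card_UN_disjoint)
    show "\<forall>F\<in>supporting_facets R. finite (?S F)"
      by (auto intro!: finite_subset[of _ "Pow R"] simp: supporting_facets_def finite_R)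
    show "\<forall>F\<in>supporting_facets R. \<forall>F'\<in>supporting_facets R. F \<noteq> F' \<longrightarrow> ?S F \<inter> ?S F' = {}"
    proof (intro ballI impI, rule ccontr)
      fix F F' assume F: "F \<in> supporting_facets R" "F' \<in> supporting_facets R" "F \<noteq> F'"
        and "?S F \<inter> ?S F' \<noteq> {}"
      then obtain G where "G \<in> ?S F" "G \<in> ?S F'"
        by blast
      then show False
        using facet_above_unique[OF F(1) _ _ F(2), of G] F(3) by blast
    qed
  qed (rule finite_supporting_facets)
  ultimately show ?thesis
    using n_subsets[OF finite_R, of j] by metis
qed

text \<open>Inclusion-exclusion, with the terms moved so that no subtraction occurs: the binomials count the
  \<open>j\<close>-sets between an \<open>x\<close>-set and a \<open>5\<close>-set.\<close>

lemma choose_indicator: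
  assumes "x \<le> 5"
  shows "(if x \<le> 2 then 1 else 0) + 3 * (if x \<le> 1 then (5 - x) choose (1 - x) else 0) =
    (if x \<le> 2 then (5 - x) choose (2 - x) else 0) +
    6 * (if x \<le> 0 then (5 - x) choose (0 - x) else (0::nat))"
proof -
  consider "x = 0" | "x = 1" | "x = 2" | "x > 2"
    by linarith
  then show ?thesis
    by cases (auto simp: choose_two)
qed

text \<open>Let h_x be the number of facets with x descents and f_j the sum over facets in
  \<open>sum_facets_above\<close>. Then h_0 + h_1 + h_2 = f_2 - 3 f_1 + 6 f_0, by
  \<open>choose_indicator\<close> applied facet by facet.\<close>

lemma (in sweep) half_facet_count:
  assumes "DIM('a) = 6" "\<And>j. j \<le> 2 \<Longrightarrow> j_neighborly j R"
  shows "card {F \<in> supporting_facets R. card (F - ascents F) \<le> 2} + 3 * card R = (card R choose 2) + 6"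
proof -
  let ?x = "\<lambda>F. card (F - ascents F)"
  let ?C = "\<lambda>j F. (if ?x F \<le> j then (5 - ?x F) choose (j - ?x F) else 0)"
  have sumC: "(\<Sum>F\<in>supporting_facets R. ?C j F) = card R choose j" if "j \<le> 2" for j
  proof -
    have "card {G. F - ascents F \<subseteq> G \<and> G \<subseteq> F \<and> card G = j} = ?C j F" if "F \<in> supporting_facets R" for F
    proof -
      have "finite F" "card F = 5"
        using that assms(1) finite_R by (auto simp: supporting_facets_def intro: finite_subset)
      then show ?thesis
        using card_subsets_between[of F "F - ascents F" j] by auto
    qed
    then show ?thesis
      using sum_facets_above[OF assms(2)[OF that]] by simp
  qed
  have x5: "?x F \<le> 5" if "F \<in> supporting_facets R" for F
  proof -
    have "finite F" "card F = 5"
      using that assms(1) finite_R by (auto simp: supporting_facets_def intro: finite_subset)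
    then show ?thesis
      by (metis Diff_subset card_mono)
  qed
  have "card {F \<in> supporting_facets R. ?x F \<le> 2} = (\<Sum>F\<in>supporting_facets R. if ?x F \<le> 2 then 1 else 0)"
    using finite_supporting_facets by (simp add: sum.If_cases Int_def)
  then have "card {F \<in> supporting_facets R. ?x F \<le> 2} + 3 * (\<Sum>F\<in>supporting_facets R. ?C 1 F) =
      (\<Sum>F\<in>supporting_facets R. (if ?x F \<le> 2 then 1 else 0) + 3 * ?C 1 F)"
    by (simp only: sum.distrib sum_distrib_left)
  also have "\<dots> = (\<Sum>F\<in>supporting_facets R. ?C 2 F + 6 * ?C 0 F)"
    by (intro sum.cong refl choose_indicator x5)
  also have "\<dots> = (\<Sum>F\<in>supporting_facets R. ?C 2 F) + 6 * (\<Sum>F\<in>supporting_facets R. ?C 0 F)"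
    by (simp only: sum.distrib sum_distrib_left)
  finally show ?thesis
    using sumC[of 0] sumC[of 1] sumC[of 2] by simp
qed

text \<open>Reversing the sweep turns ascents into descents, which is the symmetry \<open>h j = h (5 - j)\<close>
  of the h-vector.\<close>

lemma card_supporting_facets:
  fixes R :: "'a::euclidean_space set"
  assumes "generic R" "DIM('a) = 6" "6 \<le> card R" "\<And>j. j \<le> 2 \<Longrightarrow> j_neighborly j R"
  shows "card (supporting_facets R) + 6 * card R = 2 * (card R choose 2) + 12"
proof -
  obtain l c where sw: "sweep R l c"
    using sweep_exists[OF assms(1)] assms(2,3) by auto
  interpret A: sweep R l c
    by fact
  interpret B: sweep R l "- c"
    using sw by (rule sweep_uminus)
  \<comment> \<open>The two numbers of descents add up to 5, so exactly one of them is at most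
    2.\<close>
  have "card (F - B.ascents F) \<le> 2 \<longleftrightarrow> \<not> card (F - A.ascents F) \<le> 2" if "F \<in> supporting_facets R" for F
  proof -
    have F: "F \<subseteq> R" "card F = 5"
      using that assms(2) by (auto simp: supporting_facets_def)
    then have "B.ascents F = F - A.ascents F"
      using ascents_uminus[OF sw] assms(2) by simp
    moreover have "A.ascents F \<subseteq> F"
      by (auto simp: A.ascents_def)
    moreover have "finite F"
      using F A.finite_R finite_subset by blast
    ultimately have "card (F - B.ascents F) + card (F - A.ascents F) = 5"
      using F(2) by (metis card_Diff_subset card_mono double_diff finite_subset le_add_diff_inverse order_refl)
    then show ?thesis
      by linarith
  qed
  then have *: "{F \<in> supporting_facets R. card (F - B.ascents F) \<le> 2} =
      {F \<in> supporting_facets R. \<not> card (F - A.ascents F) \<le> 2}"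
    by blast
  have "card (supporting_facets R) = card {F \<in> supporting_facets R. card (F - A.ascents F) \<le> 2} +
      card {F \<in> supporting_facets R. card (F - B.ascents F) \<le> 2}"
    unfolding * using A.finite_supporting_facets
    by (subst card_Un_disjoint[symmetric]) (auto intro!: arg_cong[where f=card])
  then show ?thesis
    using A.half_facet_count[OF assms(2,4)] B.half_facet_count[OF assms(2,4)] by linarith
qed

section \<open>Oriented facets with empty positive side\<close>

text \<open>The only candidate is \<open>F\<close> itself, and no element lies off its hyperplane,
  so both orientations count.\<close>

lemma card_oriented_facets_simplex:
  fixes F :: "'a::euclidean_space set"
  assumes "generic F" "card F = DIM('a) - 1"
  shows "card (oriented_facets 0 F) = 2"
proof -
  have "independent F" and fin: "finite F"
    using assms by (auto simp: generic_def)
  then obtain w where w: "\<And>a. a \<in> F \<Longrightarrow> w \<bullet> a = 0"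
    "sides F = {{x. w \<bullet> x > 0}, {x. w \<bullet> x < 0}}" "{x. w \<bullet> x > 0} \<noteq> {x. w \<bullet> x < 0}"
    using sides_eq[of F] assms(2) by metis
  have "oriented_facets 0 F = {F} \<times> sides F"
  proof (intro equalityI subsetI)
    fix z assume "z \<in> oriented_facets 0 F"
    then show "z \<in> {F} \<times> sides F"
      using fin assms(2) card_subset_eq[of F] by (auto simp: oriented_facets_def)
  next
    fix z assume z: "z \<in> {F} \<times> sides F"
    then have "F \<inter> snd z = {}"
      using w by fastforce
    then show "z \<in> oriented_facets 0 F"
      using z assms(2) by (auto simp: oriented_facets_def)
  qed
  then show ?thesis
    using w(2,3) by (simp add: card_cartesian_product)
qed

text \<open>Some element of \<open>R\<close> lies strictly on one side of the hyperplane of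
  \<open>F\<close>, so at most one orientation has an empty positive side. Its normal is the
  negative of the supporting functional.\<close>

lemma card_oriented_facets_0:
  fixes R :: "'a::euclidean_space set"
  assumes gen: "generic R" and card: "DIM('a) \<le> card R"
  shows "card (oriented_facets 0 R) = card (supporting_facets R)"
proof -
  have fin: "finite R"
    using gen by (simp add: generic_def)
  have sub: "\<exists>x. x \<in> R - F" if "F \<subseteq> R" "card F = DIM('a) - 1" for F
  proof -
    have "card F < card R"
      using that(2) card DIM_positive[where 'a='a] by linarith
    then have "F \<noteq> R"
      by auto
    then show ?thesis
      using that by blast
  qed
  have "inj_on fst (oriented_facets 0 R)"
  proof (rule inj_onI)
    fix p q assume p: "p \<in> oriented_facets 0 R" "q \<in> oriented_facets 0 R" "fst p = fst q"
    obtain F H H' where eq: "p = (F, H)" "q = (F, H')"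
      using p(3) by (metis prod.collapse)
    have F: "F \<subseteq> R" "card F = DIM('a) - 1" "H \<in> sides F" "H' \<in> sides F" "R \<inter> H = {}" "R \<inter> H' = {}"
      using p fin unfolding eq oriented_facets_def by auto
    have "independent F"
      using F gen by (simp add: generic_def)
    then obtain w where w: "w \<noteq> 0" "\<And>a. a \<in> F \<Longrightarrow> w \<bullet> a = 0"
      "sides F = {{x. w \<bullet> x > 0}, {x. w \<bullet> x < 0}}"
      using sides_eq[of F] F(2) by metis
    obtain x where x: "x \<in> R - F"
      using sub F by blast
    then have "w \<bullet> x \<noteq> 0"
      using generic_sides_nonzero[OF gen F(1,2) w(1,2)] by blast
    then have "\<not> (H = {x. w \<bullet> x > 0} \<and> H' = {x. w \<bullet> x < 0})" "\<not> (H = {x. w \<bullet> x < 0} \<and> H' = {x. w \<bullet> x > 0})"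
      using x F(5,6) by (auto simp: disjoint_iff) (metis linorder_neqE)+
    then have "H = H'"
      using F(3,4) w(3) by auto
    then show "p = q"
      by (simp add: eq)
  qed
  moreover have "fst ` oriented_facets 0 R = supporting_facets R"
  proof (intro equalityI subsetI)
    fix F assume "F \<in> fst ` oriented_facets 0 R"
    then obtain H where F: "F \<subseteq> R" "card F = DIM('a) - 1" "H \<in> sides F" "R \<inter> H = {}"
      using fin by (auto simp: oriented_facets_def)
    then obtain w where w: "w \<noteq> 0" "\<And>a. a \<in> F \<Longrightarrow> w \<bullet> a = 0" "H = {x. w \<bullet> x > 0}"
      by (auto simp: sides_def)
    have "(- w) \<bullet> a > 0" if "a \<in> R - F" for a
      using generic_sides_nonzero[OF gen F(1,2) w(1,2) that] that F(4) w(3) by force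
    then show "F \<in> supporting_facets R"
      using F w(2) unfolding supporting_facets_def by (auto intro!: exI[of _ "- w"])
  next
    fix F assume "F \<in> supporting_facets R"
    then obtain w where F: "F \<subseteq> R" "card F = DIM('a) - 1"
      and w: "\<And>a. a \<in> F \<Longrightarrow> w \<bullet> a = 0" "\<And>a. a \<in> R - F \<Longrightarrow> w \<bullet> a > 0"
      by (auto simp: supporting_facets_def)
    obtain x where "x \<in> R - F"
      using sub F by blast
    then have "- w \<noteq> 0"
      using w(2) by fastforce
    moreover have "\<forall>a\<in>F. (- w) \<bullet> a = 0"
      using w(1) by simp
    ultimately have "{x. (- w) \<bullet> x > 0} \<in> sides F"
      unfolding sides_def by blast
    moreover have "R \<inter> {x. (- w) \<bullet> x > 0} = {}"
      using w by fastforce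
    ultimately have "(F, {x. (- w) \<bullet> x > 0}) \<in> oriented_facets 0 R"
      using F unfolding oriented_facets_def by (simp only: mem_Collect_eq case_prod_conv card.empty simp_thms)
    then show "F \<in> fst ` oriented_facets 0 R"
      by (metis fst_conv imageI)
  qed
  ultimately show ?thesis
    by (metis card_image)
qed

text \<open>From 6 elements on, the relation of \<open>card_supporting_facets\<close> is solved for
  the count. With 5 elements the two orientations of a single hyperplane give 2 = 2 * 1, in
  agreement with the formula.\<close>

lemma card_oriented_facets_neighborly:
  fixes R :: "'a::euclidean_space set"
  assumes "generic R" "DIM('a) = 6" "5 \<le> card R" "\<And>j. j \<le> 2 \<Longrightarrow> j_neighborly j R"
  shows "card (oriented_facets 0 R) = (card R - 3) * (card R - 4)"
proof (cases "card R = 5")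
  case True
  then have "card (oriented_facets 0 R) = 2"
    using assms(2) by (intro card_oriented_facets_simplex[OF assms(1)]) simp
  with True show ?thesis
    by simp
next
  case False
  with assms(3) have ge: "6 \<le> card R"
    by linarith
  then obtain m where m: "card R = 6 + m"
    using le_Suc_ex by blast
  have "card (oriented_facets 0 R) = card (supporting_facets R)"
    using ge assms(2) by (intro card_oriented_facets_0[OF assms(1)]) simp
  moreover have "card (supporting_facets R) + 6 * card R = 2 * (card R choose 2) + 12"
    by (rule card_supporting_facets[OF assms(1,2) ge assms(4)])
  moreover have "2 * (card R choose 2) = card R * (card R - 1)"
    using times_binomial_minus1_eq[of 2 "card R"] by simp
  ultimately show ?thesis
    by (simp add: m algebra_simps)
qed

section \<open>From facets of subsets to k-facets\<close>

lemma sum_indicator_card: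
  "finite S \<Longrightarrow> (\<Sum>x\<in>S. if P x then 1 else 0 :: nat) = card {x \<in> S. P x}"
  by (simp add: sum.If_cases Int_def)

lemma finite_sides:
  fixes A :: "'a::euclidean_space set"
  assumes gen: "generic A"
  shows "finite {(F, H). F \<subseteq> A \<and> card F = DIM('a) - 1 \<and> H \<in> sides F}"
proof -
  have "finite (sides F)" if "F \<subseteq> A" "card F = DIM('a) - 1" for F
  proof -
    have "independent F"
      using gen that by (simp add: generic_def)
    then show ?thesis
      using that(2) by (metis finite.emptyI finite.insertI sides_eq)
  qed
  moreover have "{(F, H). F \<subseteq> A \<and> card F = DIM('a) - 1 \<and> H \<in> sides F} =
      Sigma {F. F \<subseteq> A \<and> card F = DIM('a) - 1} sides"
    by auto
  moreover have "finite {F. F \<subseteq> A \<and> card F = DIM('a) - 1}"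
    using gen by (simp add: generic_def)
  ultimately show ?thesis
    by (simp only:) (rule finite_SigmaI; simp)
qed

lemma finite_oriented_facets: "generic A \<Longrightarrow> finite (oriented_facets k A)"
  by (rule finite_subset[OF _ finite_sides]) (auto simp: oriented_facets_def)

text \<open>Double counting of pairs of a sample \<open>R\<close> and a 0-facet
  \<open>(F, H)\<close> of it. For fixed \<open>(F, H)\<close> the samples are those between
  \<open>F\<close> and \<open>A - H\<close>; if \<open>k\<close> elements of \<open>A\<close> lie in
  \<open>H\<close>, the rest of \<open>R\<close> is chosen from the elements outside
  \<open>F\<close> and \<open>H\<close>.\<close>

lemma sampling_oriented_facets:
  fixes A :: "'a::euclidean_space set"
  assumes gen: "generic A" and r: "DIM('a) - 1 \<le> r"
  shows "(\<Sum>R | R \<subseteq> A \<and> card R = r. card (oriented_facets 0 R)) =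
    (\<Sum>k \<le> card A - (DIM('a) - 1).
       card (oriented_facets k A) * ((card A - (DIM('a) - 1) - k) choose (r - (DIM('a) - 1))))"
proof -
  define d where "d = DIM('a) - 1"
  define Z where "Z = {(F, H). F \<subseteq> A \<and> card F = d \<and> H \<in> sides F}"
  define N where "N = card A - d"
  have fin: "finite A"
    using gen by (simp add: generic_def)
  have finZ: "finite Z"
    unfolding Z_def d_def using gen by (rule finite_sides)
  have FH: "finite F" "F \<inter> H = {}" if "(F, H) \<in> Z" for F H
    using that fin by (auto simp: Z_def sides_def intro: finite_subset)
  have "(\<Sum>R | R \<subseteq> A \<and> card R = r. card (oriented_facets 0 R)) =
      (\<Sum>R | R \<subseteq> A \<and> card R = r. card {z \<in> Z. fst z \<subseteq> R \<and> R \<inter> snd z = {}})"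
  proof (intro sum.cong refl arg_cong[where f=card] set_eqI)
    fix R z assume "R \<in> {R. R \<subseteq> A \<and> card R = r}"
    then show "z \<in> oriented_facets 0 R \<longleftrightarrow> z \<in> {z \<in> Z. fst z \<subseteq> R \<and> R \<inter> snd z = {}}"
      using finite_subset[OF _ fin, of R] by (cases z) (auto simp: oriented_facets_def Z_def d_def)
  qed
  also have "\<dots> = (\<Sum>R | R \<subseteq> A \<and> card R = r. \<Sum>z\<in>Z. if fst z \<subseteq> R \<and> R \<inter> snd z = {} then 1 else 0)"
    by (simp only: sum_indicator_card[OF finZ])
  also have "\<dots> = (\<Sum>z\<in>Z. \<Sum>R | R \<subseteq> A \<and> card R = r. if fst z \<subseteq> R \<and> R \<inter> snd z = {} then 1 else 0)"
    by (rule sum.swap)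
  also have "\<dots> = (\<Sum>z\<in>Z. (N - card (A \<inter> snd z)) choose (r - d))"
  proof (rule sum.cong[OF refl])
    fix z assume z: "z \<in> Z"
    obtain F H where [simp]: "z = (F, H)"
      by (cases z)
    have F: "F \<subseteq> A - H" "card F = d" "finite F"
      using FH[of F H] z unfolding Z_def by auto
    have finP: "finite {R. R \<subseteq> A \<and> card R = r}"
      using fin by simp
    have "(\<Sum>R | R \<subseteq> A \<and> card R = r. if fst z \<subseteq> R \<and> R \<inter> snd z = {} then 1 else 0) =
        card {R \<in> {R. R \<subseteq> A \<and> card R = r}. F \<subseteq> R \<and> R \<inter> H = {}}"
      using sum_indicator_card[OF finP, of "\<lambda>R. F \<subseteq> R \<and> R \<inter> H = {}"] by simp
    also have "{R \<in> {R. R \<subseteq> A \<and> card R = r}. F \<subseteq> R \<and> R \<inter> H = {}} =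
        {R. F \<subseteq> R \<and> R \<subseteq> A - H \<and> card R = r}"
      by blast
    also have "card \<dots> = (card (A - H) - d) choose (r - d)"
      using card_subsets_between[of "A - H" F r] fin F(1,2) r unfolding d_def by simp
    also have "card (A - H) - d = N - card (A \<inter> H)"
      using fin by (simp add: N_def card_Diff_subset_Int)
    finally show "(\<Sum>R | R \<subseteq> A \<and> card R = r. if fst z \<subseteq> R \<and> R \<inter> snd z = {} then 1 else 0) =
        (N - card (A \<inter> snd z)) choose (r - d)"
      by simp
  qed
  \<comment> \<open>The oriented sets are grouped by the number \<open>k\<close> of elements on the
    positive side; \<open>k\<close> is at most \<open>N\<close> because \<open>F\<close> misses that
    side.\<close>
  also have "\<dots> = (\<Sum>k\<le>N. \<Sum>z | z \<in> Z \<and> card (A \<inter> snd z) = k. (N - card (A \<inter> snd z)) choose (r - d))"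
  proof (rule sum.group[symmetric])
    show "(\<lambda>z. card (A \<inter> snd z)) ` Z \<subseteq> {..N}"
    proof clarsimp
      fix F H assume z: "(F, H) \<in> Z"
      then have F: "F \<subseteq> A" "card F = d"
        by (auto simp: Z_def)
      have "A \<inter> H \<subseteq> A - F"
        using FH(2)[OF z] by auto
      then have "card (A \<inter> H) \<le> card (A - F)"
        using fin by (simp add: card_mono)
      then show "card (A \<inter> H) \<le> N"
        using F FH(1)[OF z] by (simp add: card_Diff_subset N_def)
    qed
  qed (use finZ in auto)
  also have "\<dots> = (\<Sum>k\<le>N. card (oriented_facets k A) * ((N - k) choose (r - d)))"
  proof (rule sum.cong[OF refl])
    fix k
    have "{z \<in> Z. card (A \<inter> snd z) = k} = oriented_facets k A"
      by (auto simp: Z_def oriented_facets_def d_def)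
    moreover have "(\<Sum>z | z \<in> Z \<and> card (A \<inter> snd z) = k. (N - card (A \<inter> snd z)) choose (r - d)) =
        (\<Sum>z | z \<in> Z \<and> card (A \<inter> snd z) = k. (N - k) choose (r - d))"
      by (rule sum.cong) auto
    ultimately show "(\<Sum>z | z \<in> Z \<and> card (A \<inter> snd z) = k. (N - card (A \<inter> snd z)) choose (r - d)) =
        card (oriented_facets k A) * ((N - k) choose (r - d))"
      by simp
  qed
  finally show ?thesis
    by (simp add: N_def d_def)
qed

section \<open>Binomial identities and inversion\<close>

text \<open>Here \<open>k\<close> is the position of the element number \<open>a + 1\<close> in a
  subset of \<open>{0..M}\<close> of size \<open>a + b + 1\<close>. The induction uses Pascal's rule
  in the second factor.\<close>

lemma sum_choose_convolution:
  "(\<Sum>k\<le>M. (k choose a) * ((M - k) choose b)) = Suc M choose Suc (a + b)"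
proof (induction M arbitrary: b)
  case 0
  show ?case
    by (cases a; cases b) auto
next
  case (Suc M)
  show ?case
  proof (cases b)
    case 0
    then show ?thesis
      using sum_choose_upper[of a "Suc M"] by simp
  next
    case (Suc b')
    have "(\<Sum>k\<le>Suc M. (k choose a) * ((Suc M - k) choose b)) =
        (\<Sum>k\<le>M. (k choose a) * ((Suc M - k) choose b))"
      by (simp add: Suc)
    also have "\<dots> = (\<Sum>k\<le>M. (k choose a) * ((M - k) choose b') + (k choose a) * ((M - k) choose Suc b'))"
      by (intro sum.cong refl) (simp add: Suc Suc_diff_le algebra_simps)
    also have "\<dots> = (Suc M choose Suc (a + b')) + (Suc M choose Suc (a + Suc b'))"
      by (simp only: sum.distrib Suc.IH)
    finally show ?thesis
      by (simp add: Suc)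
  qed
qed

text \<open>Both sides count the choices of a 2-set and a disjoint \<open>s\<close>-set among
  \<open>m + 2\<close> elements; the right side chooses their union first.\<close>

lemma choose_two_mult_choose:
  "((m + 2) choose 2) * (m choose s) = ((s + 2) choose 2) * ((m + 2) choose (s + 2))"
proof (cases "s \<le> m")
  case True
  then show ?thesis
    using choose_mult_lemma[of "m - s" 2 s] choose_mult[of "2" "s + 2" "m + 2"] 
    by (simp add: mult.commute)
next
  case False
  then show ?thesis
    by (simp only: binomial_eq_0 add_less_cancel_right not_le mult_0_right)
qed

text \<open>The claimed numbers of \<open>k\<close>-facets have the moments that sampling
  prescribes: \<open>choose_two_mult_choose\<close> merges the last two binomials, and a convolution
  remains.\<close>

lemma sum_neighborly_formula:
  "(\<Sum>k\<le>N. 2 * ((k + 2) choose 2) * ((N - k + 2) choose 2) * ((N - k) choose s)) =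
    ((N + 5) choose (s + 5)) * ((s + 2) * (s + 1))"
proof -
  have "(\<Sum>k\<le>N. 2 * ((k + 2) choose 2) * ((N - k + 2) choose 2) * ((N - k) choose s)) =
      2 * ((s + 2) choose 2) * (\<Sum>k\<le>N. ((k + 2) choose 2) * ((N - k + 2) choose (s + 2)))"
    unfolding sum_distrib_left
    by (intro sum.cong refl) (use choose_two_mult_choose in \<open>simp add: mult_ac\<close>)
  also have "(\<Sum>k\<le>N. ((k + 2) choose 2) * ((N - k + 2) choose (s + 2))) =
      (\<Sum>j\<in>(\<lambda>k. k + 2) ` {..N}. (j choose 2) * ((N + 4 - j) choose (s + 2)))"
  proof (rule sum.reindex_cong[symmetric, OF _ refl])
    fix k assume "k \<in> {..N}"
    then have "N - k + 2 = N + 4 - (k + 2)"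
      by simp
    then show "(k + 2 choose 2) * (N + 4 - (k + 2) choose (s + 2)) = (k + 2 choose 2) * (N - k + 2 choose (s + 2))"
      by (simp only:)
  qed (simp add: inj_on_def)
  \<comment> \<open>The four added terms vanish: \<open>j < 2\<close> kills the first factor, and
    \<open>j > N + 2\<close> the second.\<close>
  also have "\<dots> = (\<Sum>j\<le>N + 4. (j choose 2) * ((N + 4 - j) choose (s + 2)))"
  proof (intro sum.mono_neutral_left ballI)
    fix j assume j: "j \<in> {..N + 4} - (\<lambda>k. k + 2) ` {..N}"
    have "j < 2 \<or> j > N + 2"
    proof (rule ccontr)
      assume "\<not> (j < 2 \<or> j > N + 2)"
      then have "j = (j - 2) + 2" "j - 2 \<in> {..N}"
        by auto
      with j show False
        by blast
    qed
    then show "(j choose 2) * ((N + 4 - j) choose (s + 2)) = 0"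
      by auto
  qed auto
  also have "\<dots> = (N + 5) choose (s + 5)"
    using sum_choose_convolution[where M="N + 4" and a=2 and b="s + 2"] by (simp add: eval_nat_numeral)
  also have "2 * ((s + 2) choose 2) = (s + 2) * (s + 1)"
    using times_binomial_minus1_eq[of 2 "s + 2"] by simp
  finally show ?thesis
    by (simp only: mult.commute)
qed

text \<open>The system is triangular: for \<open>s = N - k\<close> the terms beyond \<open>k\<close>
  vanish and the term at \<open>k\<close> has coefficient 1.\<close>

lemma binomial_moments_inject:
  fixes e g :: "nat \<Rightarrow> nat"
  assumes "\<And>s. s \<le> N \<Longrightarrow> (\<Sum>k\<le>N. e k * ((N - k) choose s)) = (\<Sum>k\<le>N. g k * ((N - k) choose s))"
    and "k \<le> N"
  shows "e k = g k"
  using assms(2)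
proof (induction k rule: less_induct)
  case (less k)
  have split: "(\<Sum>j\<le>N. f j * ((N - j) choose (N - k))) = (\<Sum>j<k. f j * ((N - j) choose (N - k))) + f k"
    for f :: "nat \<Rightarrow> nat"
  proof -
    have "(\<Sum>j\<le>N. f j * ((N - j) choose (N - k))) = (\<Sum>j\<in>insert k {..<k}. f j * ((N - j) choose (N - k)))"
      by (rule sum.mono_neutral_right) (use less.prems in auto)
    then show ?thesis
      by simp
  qed
  have "(\<Sum>j<k. e j * ((N - j) choose (N - k))) = (\<Sum>j<k. g j * ((N - j) choose (N - k)))"
    using less by (intro sum.cong) auto
  then show ?case
    using assms(1)[of "N - k"] split[of e] split[of g] by simp
qed

text \<open>Genericity and neighborliness pass to samples, so sampling gives all binomial moments of
  the sequence of counts; the closed form has the same moments. Beyond \<open>N\<close> there are no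
  facets and the last binomial is 0.\<close>

theorem card_oriented_facets_two_neighborly:
  fixes A :: "'a::euclidean_space set"
  assumes gen: "generic A" and dim: "DIM('a) = 6" and card: "5 \<le> card A"
    and nb: "\<And>j. j \<le> 2 \<Longrightarrow> j_neighborly j A"
  shows "card (oriented_facets k A) = 2 * ((k + 2) choose 2) * ((card A - k - 3) choose 2)"
proof -
  obtain N where N: "card A = 5 + N"
    using card le_Suc_ex by blast
  have fin: "finite A"
    using gen by (simp add: generic_def)
  show ?thesis
  proof (cases "k \<le> N")
    case True
    have "card (oriented_facets k A) = 2 * ((k + 2) choose 2) * ((N - k + 2) choose 2)"
    proof (rule binomial_moments_inject[OF _ True])
      fix s assume "s \<le> N"
      have "(\<Sum>k\<le>N. card (oriented_facets k A) * ((N - k) choose s)) =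
          (\<Sum>R | R \<subseteq> A \<and> card R = s + 5. card (oriented_facets 0 R))"
        using sampling_oriented_facets[OF gen, of "s + 5"] dim N by simp
      also have "\<dots> = (\<Sum>R | R \<subseteq> A \<and> card R = s + 5. (s + 2) * (s + 1))"
      proof (rule sum.cong[OF refl])
        fix R assume R: "R \<in> {R. R \<subseteq> A \<and> card R = s + 5}"
        then have "card (oriented_facets 0 R) = (card R - 3) * (card R - 4)"
          by (intro card_oriented_facets_neighborly dim generic_subset[OF gen] j_neighborly_subset[OF nb]) auto
        then show "card (oriented_facets 0 R) = (s + 2) * (s + 1)"
          using R by (simp add: eval_nat_numeral)
      qed
      also have "\<dots> = ((N + 5) choose (s + 5)) * ((s + 2) * (s + 1))"
        using n_subsets[OF fin, of "s + 5"] by (simp add: N add.commute)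
      finally show "(\<Sum>k\<le>N. card (oriented_facets k A) * ((N - k) choose s)) =
          (\<Sum>k\<le>N. 2 * ((k + 2) choose 2) * ((N - k + 2) choose 2) * ((N - k) choose s))"
        by (simp only: sum_neighborly_formula)
    qed
    moreover have "card A - k - 3 = N - k + 2"
      using N True by simp
    ultimately show ?thesis
      by simp
  next
    case False
    have "oriented_facets k A = {}"
    proof (rule ccontr)
      assume "oriented_facets k A \<noteq> {}"
      then obtain F H where F: "F \<subseteq> A" "card F = 5" "H \<in> sides F" "card (A \<inter> H) = k"
        using dim by (auto simp: oriented_facets_def)
      then have "A \<inter> H \<subseteq> A - F"
        by (auto simp: sides_def)
      then have "k \<le> card (A - F)"
        using F(4) fin by (metis card_mono finite_Diff)
      also have "\<dots> = N"
        using F N fin by (simp add: card_Diff_subset finite_subset)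
      finally show False
        using False by simp
    qed
    moreover have "card A - k - 3 < 2"
      using False N by simp
    ultimately show ?thesis
      by simp
  qed
qed

section \<open>Homogenisation of point sets\<close>

text \<open>Homogenisation: the affine functional \<open>x \<mapsto> a \<bullet> x - b\<close> becomes the inner product of
  \<open>(a, b)\<close> with \<open>lift x\<close>.\<close>

definition lift :: "'a \<Rightarrow> 'a \<times> real" where
  "lift x = (x, - 1)"

lemma inj_lift: "inj_on lift A"
  by (simp add: inj_on_def lift_def)

lemma inner_lift: "w \<bullet> lift x = fst w \<bullet> x - snd w"
  by (simp add: lift_def inner_prod_def)

text \<open>The last coordinate of a linear relation among lifted points says that the coefficients
  sum to 0, so the relation is an affine one among the points.\<close>

lemma independent_lift:
  fixes T :: "'a::euclidean_space set"
  assumes "\<not> affine_dependent T"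
  shows "independent (lift ` T)"
proof
  have fin: "finite T"
    using assms by (rule aff_independent_finite)
  assume "dependent (lift ` T)"
  then obtain u v where u: "v \<in> lift ` T" "u v \<noteq> 0" "(\<Sum>z\<in>lift ` T. u z *\<^sub>R z) = 0"
    using dependent_finite[OF finite_imageI[OF fin, of lift]] by blast
  have "(\<Sum>x\<in>T. u (lift x) *\<^sub>R lift x) = 0"
    using u(3) by (simp add: sum.reindex[OF inj_lift])
  then have "(\<Sum>x\<in>T. u (lift x) *\<^sub>R x) = 0" "(\<Sum>x\<in>T. u (lift x)) = 0"
    by (auto simp: prod_eq_iff lift_def fst_sum snd_sum sum_negf)
  then have "affine_dependent T"
    using u(1,2) fin unfolding affine_dependent_explicit_finite[OF fin]
    by (intro exI[of _ "\<lambda>x. u (lift x)"]) auto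
  with assms show False
    by contradiction
qed

lemma affine_independent_of_general_position:
  fixes P :: "'a::euclidean_space set"
  assumes "finite P" "general_linear_position P" "T \<subseteq> P" "card T \<le> DIM('a) + 1"
  shows "\<not> affine_dependent T"
proof -
  obtain T' where "T \<subseteq> T'" "T' \<subseteq> P" "card T' = DIM('a) + 1"
    using exists_subset_between[of T "DIM('a) + 1" P] assms by (auto simp: general_linear_position_def)
  then show ?thesis
    using assms(2) affine_dependent_subset unfolding general_linear_position_def by blast
qed

lemma generic_lift:
  fixes P :: "'a::euclidean_space set"
  assumes "finite P" "general_linear_position P"
  shows "generic (lift ` P)"
  unfolding generic_def
proof (intro conjI allI impI)
  fix B assume B: "B \<subseteq> lift ` P" "card B \<le> DIM('a \<times> real)"
  then obtain T where T: "T \<subseteq> P" "B = lift ` T"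
    by (auto simp: subset_image_iff)
  then have "card T \<le> DIM('a) + 1"
    using B(2) by (simp add: card_image inj_lift)
  then show "independent B"
    using T affine_independent_of_general_position[OF assms] independent_lift by blast
qed (use assms in simp)

lemma hyperplane_eq_affine_hull:
  fixes D :: "'a::euclidean_space set"
  assumes "\<not> affine_dependent D" "card D = DIM('a)" "a \<noteq> 0" "\<And>x. x \<in> D \<Longrightarrow> a \<bullet> x = b"
  shows "affine hull D = {x. a \<bullet> x = b}"
proof (rule affine_dim_equal)
  show "affine hull D \<subseteq> {x. a \<bullet> x = b}"
    using assms(4) by (intro hull_minimal affine_hyperplane) auto
  show "aff_dim (affine hull D) = aff_dim {x. a \<bullet> x = b}"
    using aff_dim_affine_independent[OF assms(1)] assms(2,3) by simp
  show "affine hull D \<noteq> {}"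
    using assms(2) by auto
qed (auto simp: affine_hyperplane)

lemma fst_nonzero_if_orthogonal_lift:
  fixes w :: "'a::euclidean_space \<times> real"
  assumes "w \<noteq> 0" "D \<noteq> {}" "\<And>z. z \<in> lift ` D \<Longrightarrow> w \<bullet> z = 0"
  shows "fst w \<noteq> 0"
proof
  assume "fst w = 0"
  moreover obtain x where "x \<in> D"
    using assms(2) by blast
  then have "fst w \<bullet> x - snd w = 0"
    using assms(3)[of "lift x"] by (simp add: inner_lift)
  ultimately show False
    using assms(1) by (simp add: prod_eq_iff)
qed

text \<open>The preimage under \<open>lift\<close> of the linear half-space with normal
  \<open>(a, b)\<close> is the affine half-space \<open>a \<bullet> x > b\<close>. Since
  \<open>D\<close> is nonempty, a nonzero normal vanishing on \<open>lift\<close> followed by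
  \<open>D\<close> has a nonzero first component.\<close>

lemma orientations_affine_hull:
  fixes D :: "'a::euclidean_space set"
  assumes D: "\<not> affine_dependent D" "card D = DIM('a)"
  shows "orientations (affine hull D) = (\<lambda>H. lift -` H) ` sides (lift ` D)"
proof (intro equalityI subsetI)
  fix H assume "H \<in> orientations (affine hull D)"
  then obtain a b where ab: "a \<noteq> 0" "affine hull D = {x. a \<bullet> x = b}" "H = {x. a \<bullet> x > b}"
    by (auto simp: orientations_def)
  have "(a, b) \<bullet> z = 0" if "z \<in> lift ` D" for z
    using that ab(2) hull_subset[of D affine] by (auto simp: inner_lift)
  moreover have "(a, b) \<noteq> 0"
    using ab(1) by (simp add: prod_eq_iff)
  ultimately have "{z. (a, b) \<bullet> z > 0} \<in> sides (lift ` D)"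
    unfolding sides_def using \<open>(a, b) \<noteq> 0\<close> by blast
  moreover have "H = lift -` {z. (a, b) \<bullet> z > 0}"
    using ab(3) by (auto simp: inner_lift)
  ultimately show "H \<in> (\<lambda>H. lift -` H) ` sides (lift ` D)"
    by blast
next
  have ne: "D \<noteq> {}"
    using D(2) by auto
  fix H assume "H \<in> (\<lambda>H. lift -` H) ` sides (lift ` D)"
  then obtain w where w: "w \<noteq> 0" "\<And>z. z \<in> lift ` D \<Longrightarrow> w \<bullet> z = 0" "H = lift -` {z. w \<bullet> z > 0}"
    unfolding sides_def by blast
  have a: "fst w \<noteq> 0"
    using fst_nonzero_if_orthogonal_lift w(1,2) ne by blast
  moreover have "affine hull D = {x. fst w \<bullet> x = snd w}"
    using w(2)[OF imageI] by (intro hyperplane_eq_affine_hull D a) (simp add: inner_lift)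
  moreover have "H = {x. fst w \<bullet> x > snd w}"
    using w(3) by (auto simp: inner_lift)
  ultimately show "H \<in> orientations (affine hull D)"
    unfolding orientations_def by blast
qed

lemma inj_on_vimage_lift_sides:
  fixes D :: "'a::euclidean_space set"
  assumes D: "\<not> affine_dependent D" "card D = DIM('a)"
  shows "inj_on (\<lambda>H. lift -` H) (sides (lift ` D))"
proof -
  have ne: "D \<noteq> {}"
    using D(2) by auto
  have "card (lift ` D) = DIM('a \<times> real) - 1"
    using D(2) by (simp add: card_image inj_lift)
  then obtain w where w: "w \<noteq> 0" "\<And>z. z \<in> lift ` D \<Longrightarrow> w \<bullet> z = 0"
    "sides (lift ` D) = {{z. w \<bullet> z > 0}, {z. w \<bullet> z < 0}}"
    using sides_eq[OF independent_lift[OF D(1)]] by metis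
  \<comment> \<open>This point solves \<open>fst w \<bullet> x - snd w = 1\<close>, so it separates
    the preimages of the two sides.\<close>
  let ?x = "((snd w + 1) / (fst w \<bullet> fst w)) *\<^sub>R fst w"
  have "fst w \<noteq> 0"
    using fst_nonzero_if_orthogonal_lift w(1,2) ne by blast
  then have "w \<bullet> lift ?x = 1"
    by (simp add: inner_lift)
  then have "?x \<in> lift -` {z. w \<bullet> z > 0}" "?x \<notin> lift -` {z. w \<bullet> z < 0}"
    by simp_all
  then have "lift -` {z. w \<bullet> z > 0} \<noteq> lift -` {z. w \<bullet> z < 0}"
    by blast
  then show ?thesis
    unfolding w(3) by (auto simp: inj_on_def)
qed

text \<open>Carries both the count and finiteness back to the original points: injectivity of
  \<open>f\<close> and \<open>lift\<close> recovers \<open>F\<close> from its index set, and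
  \<open>inj_on_vimage_lift_sides\<close> recovers \<open>H\<close> from its affine slice.\<close>

lemma bij_betw_oriented_facets_F_k_facets:
  fixes f :: "'b \<Rightarrow> 'a::euclidean_space"
  assumes fin: "finite S" and inj: "inj_on f S" and gp: "general_linear_position (f ` S)"
  shows "bij_betw (\<lambda>(F, H). ({p \<in> S. lift (f p) \<in> F}, lift -` H))
    (oriented_facets k (lift ` f ` S)) (F_k_facets f k S)"
proof -
  let ?g = "\<lambda>p. lift (f p)"
  have injg: "inj_on ?g S"
    using inj by (auto simp: inj_on_def lift_def)
  have pre: "?g ` {p \<in> S. ?g p \<in> F} = F" if "F \<subseteq> ?g ` S" for F
    using that by auto
  have card_fQ: "card (f ` Q) = card Q" if "Q \<subseteq> S" for Q
    using inj that by (metis card_image inj_on_subset)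
  have card_gQ: "card (?g ` Q) = card Q" if "Q \<subseteq> S" for Q
    using injg that by (metis card_image inj_on_subset)
  have indep: "\<not> affine_dependent (f ` Q)" if "Q \<subseteq> S" "card Q = DIM('a)" for Q
    by (rule affine_independent_of_general_position[OF _ gp]) (use that fin card_fQ in auto)
  have card_H: "card (f ` S \<inter> lift -` H) = card (?g ` S \<inter> H)" for H
  proof -
    have "?g ` S \<inter> H = lift ` (f ` S \<inter> lift -` H)"
      by auto
    then show ?thesis
      by (simp add: card_image inj_lift)
  qed
  have img: "lift ` f ` Q = ?g ` Q" for Q
    by (simp add: image_image)
  have F_iff: "(Q, K) \<in> F_k_facets f k S \<longleftrightarrow> Q \<subseteq> S \<and> card Q = DIM('a) \<and>
      (\<exists>H\<in>sides (?g ` Q). K = lift -` H \<and> card (?g ` S \<inter> H) = k)" for Q K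
  proof (cases "Q \<subseteq> S \<and> card Q = DIM('a)")
    case True
    then have "orientations (affine hull (f ` Q)) = (\<lambda>H. lift -` H) ` sides (?g ` Q)"
      using orientations_affine_hull[OF indep] card_fQ by (simp add: img)
    then show ?thesis
      using True card_fQ card_H by (auto simp: F_k_facets_def k_facets_def)
  qed (auto simp: F_k_facets_def)
  have O_iff: "(F, H) \<in> oriented_facets k (?g ` S) \<longleftrightarrow>
      F \<subseteq> ?g ` S \<and> card F = DIM('a) \<and> H \<in> sides F \<and> card (?g ` S \<inter> H) = k" for F H
    by (simp add: oriented_facets_def)
  have "inj_on (\<lambda>(F, H). ({p \<in> S. ?g p \<in> F}, lift -` H)) (oriented_facets k (?g ` S))"
  proof (rule inj_onI, clarify)
    fix F H F' H'
    assume 1: "(F, H) \<in> oriented_facets k (?g ` S)" "(F', H') \<in> oriented_facets k (?g ` S)"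
      and 2: "{p \<in> S. ?g p \<in> F} = {p \<in> S. ?g p \<in> F'}" and 3: "lift -` H = lift -` H'"
    define Q where "Q = {p \<in> S. ?g p \<in> F}"
    have F_sub: "F \<subseteq> ?g ` S" "F' \<subseteq> ?g ` S" and F_card: "card F = DIM('a)"
      using 1 by (simp_all only: O_iff)
    have F: "F = ?g ` Q" "F' = ?g ` Q"
      unfolding Q_def using pre[OF F_sub(1)] pre[OF F_sub(2)] 2 by argo+
    have QS: "Q \<subseteq> S"
      by (simp add: Q_def)
    have Q: "Q \<subseteq> S" "card Q = DIM('a)"
      using F_card card_gQ[OF QS] F(1) QS by argo+
    have "inj_on (\<lambda>H. lift -` H) (sides (?g ` Q))"
      using inj_on_vimage_lift_sides[OF indep[OF Q]] card_fQ Q by (simp add: img)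
    then have "H = H'"
      using 1 3 F unfolding O_iff inj_on_def by blast
    then show "F = F' \<and> H = H'"
      using F by simp
  qed
  moreover have "(\<lambda>(F, H). ({p \<in> S. ?g p \<in> F}, lift -` H)) ` oriented_facets k (?g ` S) = F_k_facets f k S"
  proof (intro equalityI subsetI)
    fix z assume "z \<in> (\<lambda>(F, H). ({p \<in> S. ?g p \<in> F}, lift -` H)) ` oriented_facets k (?g ` S)"
    then obtain F H where z: "z = ({p \<in> S. ?g p \<in> F}, lift -` H)"
      and FH: "(F, H) \<in> oriented_facets k (?g ` S)"
      by auto
    then have F: "F \<subseteq> ?g ` S" "card F = DIM('a)" "H \<in> sides F" "card (?g ` S \<inter> H) = k"
      by (simp_all only: O_iff)
    then show "z \<in> F_k_facets f k S"
      unfolding z F_iff using card_gQ[of "{p \<in> S. ?g p \<in> F}"] pre[OF F(1)] by auto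
  next
    fix z assume z: "z \<in> F_k_facets f k S"
    obtain Q K where zQ: "z = (Q, K)"
      by (cases z)
    then obtain H where H: "Q \<subseteq> S" "card Q = DIM('a)" "H \<in> sides (?g ` Q)" "K = lift -` H"
      "card (?g ` S \<inter> H) = k"
      using z F_iff by blast
    then have "(?g ` Q, H) \<in> oriented_facets k (?g ` S)"
      using card_gQ unfolding O_iff by auto
    moreover have "{p \<in> S. ?g p \<in> ?g ` Q} = Q"
      using H(1) injg by (auto dest: inj_onD)
    ultimately show "z \<in> (\<lambda>(F, H). ({p \<in> S. ?g p \<in> F}, lift -` H)) ` oriented_facets k (?g ` S)"
      using zQ H(4) by (auto intro!: image_eqI[of _ _ "(?g ` Q, H)"])
  qed
  ultimately show ?thesis
    by (simp add: bij_betw_def img)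
qed

section \<open>The Veronese map and double lines\<close>

lemma exhaust_5: "x = 1 \<or> x = 2 \<or> x = 3 \<or> x = 4 \<or> x = 5" for x :: 5
proof (induct x)
  case (of_int z)
  then have "z = 0 \<or> z = 1 \<or> z = 2 \<or> z = 3 \<or> z = 4"
    by fastforce
  then show ?case
    by auto
qed

lemma sum_5: "sum f (UNIV :: 5 set) = f 1 + f 2 + f 3 + f 4 + f 5"
proof -
  have UNIV_eq: "(UNIV :: 5 set) = {1, 2, 3, 4, 5}"
    using exhaust_5 by auto
  show ?thesis
    unfolding UNIV_eq by (simp add: ac_simps)
qed

lemma vector_5:
  "(vector [x, y, z, u, v] :: 'a::zero ^ 5) $ 1 = x"
  "(vector [x, y, z, u, v] :: 'a::zero ^ 5) $ 2 = y"
  "(vector [x, y, z, u, v] :: 'a::zero ^ 5) $ 3 = z"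
  "(vector [x, y, z, u, v] :: 'a::zero ^ 5) $ 4 = u"
  "(vector [x, y, z, u, v] :: 'a::zero ^ 5) $ 5 = v"
  unfolding vector_def by simp_all

lemma inj_V22: "inj V22"
proof (rule injI)
  fix p q assume "V22 p = V22 q"
  then have "V22 p $ 4 = V22 q $ 4" "V22 p $ 5 = V22 q $ 5"
    by simp_all
  then show "p = q"
    by (simp add: V22_def vector_5 vec_eq_iff forall_2)
qed

text \<open>The conic is a double line through \<open>p\<close> and \<open>q\<close>.\<close>

lemma conic_through_two_points:
  obtains w where "w \<noteq> 0" "w \<bullet> lift (V22 p) = 0" "w \<bullet> lift (V22 q) = 0"
    "\<And>r. w \<bullet> lift (V22 r) \<ge> 0"
proof -
  obtain a b c :: real where ab: "a \<noteq> 0 \<or> b \<noteq> 0"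
    and p: "a * p$1 + b * p$2 + c = 0" and q: "a * q$1 + b * q$2 + c = 0"
  \<comment> \<open>For equal points the line with constant first coordinate is taken, otherwise the
    line through both.\<close>
  proof (cases "p = q")
    case True
    show ?thesis
      by (rule that[of 1 0 "- p$1"]) (use True in auto)
  next
    case False
    then have "p$1 \<noteq> q$1 \<or> p$2 \<noteq> q$2"
      by (simp add: vec_eq_iff forall_2)
    then show ?thesis
      by (intro that[of "q$2 - p$2" "p$1 - q$1" "p$2 * q$1 - p$1 * q$2"]) (auto simp: algebra_simps)
  qed
  \<comment> \<open>The coefficients of the squared line equation in the order of the coordinates of
    \<open>V22\<close>; the constant term changes sign because the last coordinate of
    \<open>lift\<close> is -1.\<close>
  define w :: "(real^5) \<times> real" where
    "w = (vector [a\<^sup>2, 2 * a * b, b\<^sup>2, 2 * a * c, 2 * b * c], - c\<^sup>2)"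
  have w: "w \<bullet> lift (V22 r) = (a * r$1 + b * r$2 + c)\<^sup>2" for r
    by (simp add: w_def inner_lift inner_vec_def sum_5 V22_def vector_5 power2_eq_square algebra_simps)
  have "fst w $ 1 = a\<^sup>2" "fst w $ 3 = b\<^sup>2"
    by (simp_all add: w_def vector_5)
  then have "w \<noteq> 0"
    using ab by auto
  then show ?thesis
    using that w p q by simp
qed

text \<open>At most two lifted points are involved, so the double line through their originals
  works; \<open>p\<close> and \<open>q\<close> may coincide, which covers the smaller sets.\<close>

lemma j_neighborly_lift_V22:
  assumes "j \<le> 2" "finite S" "S \<noteq> {}"
  shows "j_neighborly j (lift ` V22 ` S)"
  unfolding j_neighborly_def
proof (intro allI impI)
  fix G assume G: "G \<subseteq> lift ` V22 ` S" "card G = j"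
  then have "finite G"
    using assms(2) by (meson finite_imageI finite_subset)
  obtain s where s: "s \<in> S"
    using assms(3) by blast
  have "\<exists>p q. G \<subseteq> {lift (V22 p), lift (V22 q)}"
  proof -
    consider "card G = 0" | "card G = 1" | "card G = 2"
      using G(2) assms(1) by linarith
    then show ?thesis
    proof cases
      case 1
      then show ?thesis
        using \<open>finite G\<close> by simp
    next
      case 2
      then obtain x where "G = {x}"
        by (auto simp: card_1_singleton_iff)
      then show ?thesis
        using G(1) by auto
    next
      case 3
      then obtain x y where "G = {x, y}"
        by (auto simp: card_2_iff)
      then show ?thesis
        using G(1) by auto
    qed
  qed
  then obtain p q where pq: "G \<subseteq> {lift (V22 p), lift (V22 q)}"
    by blast
  obtain w where "w \<noteq> 0" "w \<bullet> lift (V22 p) = 0" "w \<bullet> lift (V22 q) = 0" "\<And>r. w \<bullet> lift (V22 r) \<ge> 0"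
    using conic_through_two_points by blast
  then show "\<exists>w. w \<noteq> 0 \<and> (\<forall>a\<in>G. w \<bullet> a = 0) \<and> (\<forall>a\<in>lift ` V22 ` S. w \<bullet> a \<ge> 0)"
    using pq by (intro exI[of _ w]) auto
qed

theorem theorem3p8:
  fixes S :: "(real^2) set" and n k :: nat
  assumes "finite S" and "card S = n" and "general_position_conics S"
  shows "finite (F_k_facets V22 k S) \<and>
         card (F_k_facets V22 k S) = 2 * ((k + 2) choose 2) * ((n - k - 3) choose 2)"
proof -
  let ?A = "lift ` V22 ` S"
  have gp: "general_linear_position (V22 ` S)"
    using assms(3) by (simp add: general_position_conics_def)
  have inj: "inj_on V22 S"
    using inj_V22 by (rule inj_on_subset) simp
  have card: "card ?A = n"
    using assms(2) inj by (simp add: card_image inj_lift)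
  \<comment> \<open>General linear position in dimension 5 includes having at least 6 points, and
    \<open>V22\<close> is injective.\<close>
  have "6 \<le> n"
    using gp assms(1,2) inj by (simp add: general_linear_position_def card_image)
  then have "S \<noteq> {}"
    using assms(2) by auto
  have gen: "generic ?A"
    using assms(1) gp by (intro generic_lift) auto
  have "card (oriented_facets k ?A) = 2 * ((k + 2) choose 2) * ((card ?A - k - 3) choose 2)"
    using gen
    by (rule card_oriented_facets_two_neighborly)
      (use card \<open>6 \<le> n\<close> assms(1) \<open>S \<noteq> {}\<close> j_neighborly_lift_V22 in auto)
  moreover have bij: "bij_betw (\<lambda>(F, H). ({p \<in> S. lift (V22 p) \<in> F}, lift -` H))
      (oriented_facets k ?A) (F_k_facets V22 k S)"
    using assms(1) inj gp by (rule bij_betw_oriented_facets_F_k_facets)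
  ultimately show ?thesis
    using finite_oriented_facets[OF gen] bij_betw_same_card[OF bij] bij_betw_finite[OF bij] card
    by simp
qed

end
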